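(* Let $\mathcal{M}_1=\{A\in\mathbb{C}^{3\times3}\mid\deg(m_A)\le 2\}$ and $\mathcal{N}_1=\{A\in\mathcal{M}_1\mid\mathrm{tr}(A)=0\}$, and denote by a bar the restriction of a function on $\mathbb{C}^{3\times3}$ to $\mathcal{M}_1$. Then: (i) $\mathbb{C}[\mathcal{M}_1]^U$ is a polynomial ring in $\overline{d_1}$ over the subalgebra $\mathbb{C}[\mathcal{N}_1]^U$. (ii) There is a $\mathbb{C}$-algebra isomorphism $\eta:\mathbb{C}[z^2,z^3,D,zD]\to\mathbb{C}[\mathcal{N}_1]^U$ with $\eta(z^2)=\overline{d_2}$, $\eta(z^3)=\overline{d_3}$, $\eta(D)=\overline{c_1^U}$, $\eta(zD)=\overline{c_2^U}$, where $\mathbb{C}[z^2,z^3,D,zD]$ is the subalgebra of the polynomial ring $\mathbb{C}[z,D]$ generated by these monomials. (iii) The kernel of the surjection $\varphi:\mathbb{C}[x_0,x_1,x_2,x_3,x_4]\to\mathbb{C}[\mathcal{M}_1]^U$, $x_0\mapsto\overline{d_1}$, $x_1\mapsto\overline{d_2}$, $x_2\mapsto\overline{d_3}$, $x_3\mapsto\overline{c_1^U}$, $x_4\mapsto\overline{c_2^U}$, is generated as an ideal by $x_1^3-x_2^2$, $x_1x_4-x_2x_3$, $x_4^2-x_1x_3^2$, $x_2x_4-x_1^2x_3$.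
   Context: $m_A$ is the minimal polynomial. $G=SL(3,\mathbb{C})$ acts on $\mathbb{C}^{3\times3}$ by conjugation and on functions by $(g\cdot f)(A)=f(g^{-1}Ag)$; $\mathcal{M}_1,\mathcal{N}_1$ are $G$-stable. $U$ is the group of upper unitriangular $3\times3$ matrices; $\mathbb{C}[X]^U$ denotes $U$-invariants in the coordinate ring $\mathbb{C}[X]$. $\mathbb{C}[\mathcal{N}_1]$ is viewed as a subalgebra of $\mathbb{C}[\mathcal{M}_1]$ via $f\mapsto f\circ c_1$. For $A\in\mathbb{C}^{3\times3}$: $c_1(A)=A-\frac13\mathrm{tr}(A)I_3$, $d_1(A)=\mathrm{tr}(A)$, $d_2(A)=\frac16\mathrm{tr}(c_1(A)^2)$, $d_3(A)=\frac12\det(c_1(A))$. The functions $c_1^U,c_2^U$ are the highest weight vectors associated with the covariants $c_1(A)$ and $c_2(A)=c_1(c_1(A)^2)$, normalized so that $\overline{d_3}\,\overline{c_1^U}=\overline{d_2}\,\overline{c_2^U}$; concretely one may take $c_1^U(A)=a_{31}$ (the $(3,1)$ entry of $A$) and $c_2^U(A)=(c_1(A)^2)_{31}$. *)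

theory Defs
  imports "Jordan_Normal_Form.Determinant" "HOL-Computational_Algebra.Polynomial"
begin

text \<open>Polynomial functions in the variables indexed by I (complex coefficients).
  Over the infinite field of complex numbers these are in bijection with polynomials.\<close>
inductive_set polyfun :: "'i set \<Rightarrow> (('i \<Rightarrow> complex) \<Rightarrow> complex) set" for I :: "'i set" where
  pf_const: "(\<lambda>x. c) \<in> polyfun I"
| pf_var: "i \<in> I \<Longrightarrow> (\<lambda>x. x i) \<in> polyfun I"
| pf_add: "p \<in> polyfun I \<Longrightarrow> q \<in> polyfun I \<Longrightarrow> (\<lambda>x. p x + q x) \<in> polyfun I"
| pf_mult: "p \<in> polyfun I \<Longrightarrow> q \<in> polyfun I \<Longrightarrow> (\<lambda>x. p x * q x) \<in> polyfun I"

inductive_set gen_subalg :: "(('i \<Rightarrow> complex) \<Rightarrow> complex) set \<Rightarrow> (('i \<Rightarrow> complex) \<Rightarrow> complex) set"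
  for G where
  ga_const: "(\<lambda>x. c) \<in> gen_subalg G"
| ga_gen: "g \<in> G \<Longrightarrow> g \<in> gen_subalg G"
| ga_add: "p \<in> gen_subalg G \<Longrightarrow> q \<in> gen_subalg G \<Longrightarrow> (\<lambda>x. p x + q x) \<in> gen_subalg G"
| ga_mult: "p \<in> gen_subalg G \<Longrightarrow> q \<in> gen_subalg G \<Longrightarrow> (\<lambda>x. p x * q x) \<in> gen_subalg G"

definition mat_polyfun :: "(complex mat \<Rightarrow> complex) set" where
  "mat_polyfun = {f. \<exists>p \<in> polyfun ({..<3} \<times> {..<3}).
      \<forall>A \<in> carrier_mat 3 3. f A = p (\<lambda>ij. A $$ ij)}"

text \<open>Restriction to a subset S (functions are represented canonically, being 0 off S).\<close>
definition restr :: "complex mat set \<Rightarrow> (complex mat \<Rightarrow> complex) \<Rightarrow> complex mat \<Rightarrow> complex" where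
  "restr S f = (\<lambda>A. if A \<in> S then f A else 0)"

definition coord_ring :: "complex mat set \<Rightarrow> (complex mat \<Rightarrow> complex) set" where
  "coord_ring S = restr S ` mat_polyfun"

definition U3 :: "complex mat set" where
  "U3 = {u \<in> carrier_mat 3 3. \<forall>i<3. \<forall>j<3.
           (j < i \<longrightarrow> u $$ (i,j) = 0) \<and> (i = j \<longrightarrow> u $$ (i,j) = 1)}"

definition U_invariants :: "complex mat set \<Rightarrow> (complex mat \<Rightarrow> complex) set" where
  "U_invariants S = {f \<in> coord_ring S. \<forall>u \<in> U3. \<forall>v \<in> carrier_mat 3 3.
      v * u = 1\<^sub>m 3 \<longrightarrow> (\<forall>A \<in> carrier_mat 3 3. f (v * A * u) = f A)}"

definition tr :: "complex mat \<Rightarrow> complex" where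
  "tr A = (\<Sum>i<dim_row A. A $$ (i,i))"

definition mat_poly_eval :: "complex poly \<Rightarrow> complex mat \<Rightarrow> complex mat" where
  "mat_poly_eval p A = foldr (\<lambda>c M. c \<cdot>\<^sub>m 1\<^sub>m (dim_row A) + A * M) (coeffs p) (0\<^sub>m (dim_row A) (dim_row A))"

definition minpoly_degree :: "complex mat \<Rightarrow> nat" where
  "minpoly_degree A = (LEAST n. \<exists>p. lead_coeff p = 1 \<and> degree p = n \<and>
       mat_poly_eval p A = 0\<^sub>m (dim_row A) (dim_row A))"

definition M1 :: "complex mat set" where
  "M1 = {A \<in> carrier_mat 3 3. minpoly_degree A \<le> 2}"

definition N1 :: "complex mat set" where
  "N1 = {A \<in> M1. tr A = 0}"

definition c1 :: "complex mat \<Rightarrow> complex mat" where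
  "c1 A = A - (tr A / 3) \<cdot>\<^sub>m 1\<^sub>m 3"

definition d1 :: "complex mat \<Rightarrow> complex" where "d1 A = tr A"
definition d2 :: "complex mat \<Rightarrow> complex" where "d2 A = tr (c1 A * c1 A) / 6"
definition d3 :: "complex mat \<Rightarrow> complex" where "d3 A = det (c1 A) / 2"
definition c1U :: "complex mat \<Rightarrow> complex" where "c1U A = A $$ (2,0)"
definition c2U :: "complex mat \<Rightarrow> complex" where "c2U A = (c1 A * c1 A) $$ (2,0)"

text \<open>Embedding of C[N1] into C[M1] via f \<mapsto> f \<circ> c1.\<close>
definition emb :: "(complex mat \<Rightarrow> complex) \<Rightarrow> complex mat \<Rightarrow> complex" where
  "emb f = restr M1 (\<lambda>A. f (c1 A))"

definition phi :: "((nat \<Rightarrow> complex) \<Rightarrow> complex) \<Rightarrow> complex mat \<Rightarrow> complex" where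
  "phi P = restr M1 (\<lambda>A. P (\<lambda>i. if i = 0 then d1 A else if i = 1 then d2 A else
             if i = 2 then d3 A else if i = 3 then c1U A else c2U A))"

definition rel :: "nat \<Rightarrow> (nat \<Rightarrow> complex) \<Rightarrow> complex" where
  "rel k = (if k = 0 then (\<lambda>x. x 1 ^ 3 - x 2 ^ 2)
            else if k = 1 then (\<lambda>x. x 1 * x 4 - x 2 * x 3)
            else if k = 2 then (\<lambda>x. x 4 ^ 2 - x 1 * x 3 ^ 2)
            else (\<lambda>x. x 2 * x 4 - x 1 ^ 2 * x 3))"

definition rel_ideal :: "((nat \<Rightarrow> complex) \<Rightarrow> complex) set" where
  "rel_ideal = {(\<lambda>x. \<Sum>k<4. h k x * rel k x) | h. \<forall>k<4. h k \<in> polyfun {..<5}}"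

text \<open>C[z,D] as polynomial functions in x 0 = z and x 1 = D; its subalgebra C[z^2,z^3,D,zD].\<close>
definition zD_subalg :: "((nat \<Rightarrow> complex) \<Rightarrow> complex) set" where
  "zD_subalg = gen_subalg {(\<lambda>x. x 0 ^ 2), (\<lambda>x. x 0 ^ 3), (\<lambda>x. x 1), (\<lambda>x. x 0 * x 1)}"

end

theory Submission
  imports Defs
begin

text \<open>
  A matrix with minimal polynomial of degree at most \<open>2\<close> is a scalar plus a matrix \<open>v w\<^sup>T\<close> of rank
  at most one. With \<open>t\<close> its trace, \<open>z = (v \<bullet> w) / 3\<close> and \<open>D = v\<^sub>2 w\<^sub>0\<close> (indices start at \<open>0\<close>), the
  five functions \<open>d1, d2, d3, c1U, c2U\<close> take the values \<open>t, z\<^sup>2, z\<^sup>3, D, z D\<close>. If \<open>D \<noteq> 0\<close>,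
  conjugation by \<open>U\<close> brings the matrix to a normal form depending only on \<open>(t, z, D)\<close>, so by density
  every invariant is a polynomial \<open>Q(t, z, D)\<close>. The matrices with \<open>D = 0\<close> include three diagonal
  ones with the same \<open>t, z\<close> whose derivatives in \<open>z\<close> add up to zero; hence \<open>\<partial>Q/\<partial>z\<close> vanishes at
  \<open>z = D = 0\<close>, and splitting \<open>Q\<close> into even and odd parts in \<open>z\<close> gives
  \<open>Q = A(t, z\<^sup>2, D) + z\<^sup>3 B(t, z\<^sup>2) + z D C(t, z\<^sup>2, D)\<close>. Modulo the four relations every polynomial
  has the corresponding form \<open>A(x\<^sub>0, x\<^sub>1, x\<^sub>3) + x\<^sub>2 B(x\<^sub>0, x\<^sub>1) + x\<^sub>4 C(x\<^sub>0, x\<^sub>1, x\<^sub>3)\<close>, and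
  parity in \<open>z\<close> shows that such a form vanishes on all \<open>(t, z\<^sup>2, z\<^sup>3, D, z D)\<close> only if
  \<open>A = B = C = 0\<close>.
\<close>

section \<open>Polynomial functions\<close>

lemma polyfun_uminus: "p \<in> polyfun I \<Longrightarrow> (\<lambda>x. - p x) \<in> polyfun I"
  using pf_mult[OF pf_const[of "-1"], of p I] by simp

lemma polyfun_diff:
  assumes "p \<in> polyfun I" "q \<in> polyfun I"
  shows "(\<lambda>x. p x - q x) \<in> polyfun I"
  using pf_add[OF assms(1) polyfun_uminus[OF assms(2)]] by simp

lemma polyfun_power: "p \<in> polyfun I \<Longrightarrow> (\<lambda>x. p x ^ n) \<in> polyfun I"
  by (induction n) (auto intro: pf_const pf_mult)

lemma polyfun_sum:
  "(\<And>a. a \<in> S \<Longrightarrow> f a \<in> polyfun I) \<Longrightarrow> (\<lambda>x. \<Sum>a\<in>S. f a x) \<in> polyfun I"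
  by (induction S rule: infinite_finite_induct) (auto intro: pf_const pf_add)

lemmas polyfun_intros =
  pf_const pf_var pf_add pf_mult polyfun_uminus polyfun_diff polyfun_power polyfun_sum

lemma polyfun_compose:
  assumes "p \<in> polyfun I" "\<And>i. i \<in> I \<Longrightarrow> f i \<in> polyfun J"
  shows "(\<lambda>x. p (\<lambda>i. f i x)) \<in> polyfun J"
  using assms(1) by induction (simp_all add: polyfun.intros assms(2))

lemma polyfun_mono:
  assumes "p \<in> polyfun I" "I \<subseteq> J"
  shows "p \<in> polyfun J"
  using assms(1) by induction (use assms(2) in \<open>auto intro: polyfun.intros\<close>)

lemma polyfun_cong:
  assumes "p \<in> polyfun I" "\<And>i. i \<in> I \<Longrightarrow> x i = y i"
  shows "p x = p y"
  using assms(1) by induction (auto simp: assms(2))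

lemma polyfun_upd_free:
  assumes "p \<in> polyfun I" "i \<notin> I"
  shows "p (x(i := c)) = p x"
  using assms(2) by (intro polyfun_cong[OF assms(1)]) auto

lemma polyfun_fix_var:
  assumes "p \<in> polyfun I"
  shows "(\<lambda>x. p (x(i := c))) \<in> polyfun (I - {i})"
proof -
  have "(\<lambda>x. if j = i then c else x j) \<in> polyfun (I - {i})" if "j \<in> I" for j
    using that by (cases "j = i") (auto intro: pf_const pf_var)
  then show ?thesis unfolding fun_upd_def by (rule polyfun_compose[OF assms])
qed

lemma polyfun_var_mult_induct [consumes 1, case_names one scale add var]:
  assumes "p \<in> polyfun I"
    and one: "P (\<lambda>x. 1)"
    and scale: "\<And>c q. P q \<Longrightarrow> P (\<lambda>x. c * q x)"
    and add: "\<And>q r. P q \<Longrightarrow> P r \<Longrightarrow> P (\<lambda>x. q x + r x)"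
    and var: "\<And>i q. i \<in> I \<Longrightarrow> P q \<Longrightarrow> P (\<lambda>x. x i * q x)"
  shows "P p"
proof -
  have "P (\<lambda>x. p x * q x)" if "P q" for q
    using assms(1) that
  proof (induction arbitrary: q)
    case (pf_add p p')
    then show ?case using add[of "\<lambda>x. p x * q x" "\<lambda>x. p' x * q x"] by (simp add: distrib_right)
  next
    case (pf_mult p p')
    then show ?case using pf_mult.IH(1)[of "\<lambda>x. p' x * q x"] by (simp add: mult.assoc)
  qed (auto intro: scale var)
  from this[OF one] show ?thesis by simp
qed

definition poly_family :: "'i set \<Rightarrow> (('i \<Rightarrow> complex) \<Rightarrow> complex poly) set" where
  "poly_family I =
     {q. (\<forall>k. (\<lambda>x. coeff (q x) k) \<in> polyfun I) \<and> (\<exists>n. \<forall>x. degree (q x) \<le> n)}"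

lemma poly_family_const:
  assumes "p \<in> polyfun I"
  shows "(\<lambda>x. [:p x:]) \<in> poly_family I"
proof -
  have "(\<lambda>x. coeff [:p x:] k) \<in> polyfun I" for k
    using assms by (cases k) (auto intro: pf_const)
  then show ?thesis by (auto simp: poly_family_def)
qed

lemma poly_family_X: "(\<lambda>x. [:0, 1:]) \<in> poly_family I"
  by (auto simp: poly_family_def intro: pf_const)

lemma poly_family_add:
  assumes "q \<in> poly_family I" "r \<in> poly_family I"
  shows "(\<lambda>x. q x + r x) \<in> poly_family I"
proof -
  obtain m n where "degree (q x) \<le> m" "degree (r x) \<le> n" for x
    using assms by (auto simp: poly_family_def)
  then have "degree (q x + r x) \<le> max m n" for x
    by (metis degree_add_le_max max.mono order_trans)
  then show ?thesis
    using assms by (auto simp: poly_family_def intro: pf_add)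
qed

lemma poly_family_mult:
  assumes "q \<in> poly_family I" "r \<in> poly_family I"
  shows "(\<lambda>x. q x * r x) \<in> poly_family I"
proof -
  obtain m n where "degree (q x) \<le> m" "degree (r x) \<le> n" for x
    using assms by (auto simp: poly_family_def)
  then have "degree (q x * r x) \<le> m + n" for x
    by (metis degree_mult_le add_mono order_trans)
  moreover have "(\<lambda>x. coeff (q x * r x) k) \<in> polyfun I" for k
    unfolding coeff_mult using assms
    by (intro polyfun_sum pf_mult) (simp_all add: poly_family_def)
  ultimately show ?thesis by (auto simp: poly_family_def)
qed

lemma polyfun_as_poly_family:
  assumes "p \<in> polyfun I"
  shows "\<exists>q \<in> poly_family (I - {i}). \<forall>x. p x = poly (q x) (x i)"
  using assms
proof induction
  case (pf_const c)
  show ?case by (rule bexI[OF _ poly_family_const[OF polyfun.pf_const]]) simp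
next
  case (pf_var j)
  show ?case
  proof (cases "j = i")
    case True
    then show ?thesis by (intro bexI[OF _ poly_family_X]) simp
  next
    case False
    with pf_var show ?thesis
      by (intro bexI[OF _ poly_family_const[OF polyfun.pf_var[of j]]]) simp_all
  qed
next
  case (pf_add p p')
  then obtain q q' where "q \<in> poly_family (I - {i})" "q' \<in> poly_family (I - {i})"
    "\<forall>x. p x = poly (q x) (x i)" "\<forall>x. p' x = poly (q' x) (x i)" by blast
  then show ?case by (intro bexI[OF _ poly_family_add[of q _ q']]) simp_all
next
  case (pf_mult p p')
  then obtain q q' where "q \<in> poly_family (I - {i})" "q' \<in> poly_family (I - {i})"
    "\<forall>x. p x = poly (q x) (x i)" "\<forall>x. p' x = poly (q' x) (x i)" by blast
  then show ?case by (intro bexI[OF _ poly_family_mult[of q _ q']]) simp_all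
qed

lemma polyfun_expand_var:
  assumes "p \<in> polyfun I"
  obtains n and g :: "nat \<Rightarrow> ('i \<Rightarrow> complex) \<Rightarrow> complex"
  where "\<And>k. g k \<in> polyfun (I - {i})" "\<And>x. p x = (\<Sum>k\<le>n. g k x * x i ^ k)"
proof -
  obtain q n where q: "\<And>k. (\<lambda>x. coeff (q x) k) \<in> polyfun (I - {i})"
    "\<And>x. degree (q x) \<le> n" "\<And>x. p x = poly (q x) (x i)"
    using polyfun_as_poly_family[OF assms, of i] by (auto simp: poly_family_def)
  have "p x = (\<Sum>k\<le>n. coeff (q x) k * x i ^ k)" for x
    unfolding q(3) poly_altdef using q(2)[of x]
    by (intro sum.mono_neutral_left) (auto simp: coeff_eq_0)
  with q(1) show thesis by (rule that)
qed

lemma polyfun_Horner_induct [consumes 2, case_names free Horner]: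
  assumes "p \<in> polyfun I" "i \<in> I"
    and free: "\<And>g. g \<in> polyfun (I - {i}) \<Longrightarrow> P g"
    and Horner: "\<And>g q. g \<in> polyfun (I - {i}) \<Longrightarrow> q \<in> polyfun I \<Longrightarrow> P q \<Longrightarrow> P (\<lambda>x. g x + x i * q x)"
  shows "P p"
proof -
  have "P (\<lambda>x. \<Sum>k\<le>n. g k x * x i ^ k)" if "\<And>k. g k \<in> polyfun (I - {i})"
    for n :: nat and g
    using that
  proof (induction n arbitrary: g)
    case 0
    then show ?case by (simp add: free)
  next
    case (Suc n)
    let ?q = "\<lambda>x. \<Sum>k\<le>n. g (Suc k) x * x i ^ k"
    have "?q \<in> polyfun I"
      by (intro polyfun_sum pf_mult polyfun_power pf_var \<open>i \<in> I\<close> polyfun_mono[OF Suc.prems]) blast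
    then have "P (\<lambda>x. g 0 x + x i * ?q x)"
      by (intro Horner Suc.IH Suc.prems)
    then show ?case by (simp add: sum.atMost_Suc_shift sum_distrib_left mult_ac del: sum.atMost_Suc)
  qed
  moreover obtain n :: nat and g
    where "\<And>k. g k \<in> polyfun (I - {i})" "\<And>x. p x = (\<Sum>k\<le>n. g k x * x i ^ k)"
    by (rule polyfun_expand_var[OF assms(1), of i]) (rule that)
  ultimately have "P (\<lambda>x. p x)" by simp
  then show ?thesis .
qed

lemma polyfun_split_var:
  assumes "p \<in> polyfun I" "i \<in> I"
  obtains q where "q \<in> polyfun I" "\<And>x. p x = p (x(i := 0)) + x i * q x"
proof -
  have free_of_i: "g (x(i := 0)) = g x" if "g \<in> polyfun (I - {i})" for g x
    by (rule polyfun_upd_free[OF that]) simp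
  have "\<exists>q \<in> polyfun I. \<forall>x. p x = p (x(i := 0)) + x i * q x"
    using assms
  proof (induction rule: polyfun_Horner_induct)
    case (free g)
    then have "g x = g (x(i := 0)) + x i * 0" for x by (simp add: free_of_i)
    then show ?case by (rule bexI[of _ "\<lambda>x. 0", OF allI]) (rule pf_const)
  next
    case (Horner g q)
    then have "g x + x i * q x
      = g (x(i := 0)) + (x(i := 0)) i * q (x(i := 0)) + x i * q x" for x
      by (simp add: free_of_i)
    then show ?case by (rule bexI[of _ q, OF allI]) (rule Horner(2))
  qed
  then show thesis using that by blast
qed

lemma polyfun_even_odd:
  assumes "p \<in> polyfun I" "i \<in> I"
  obtains a b where "a \<in> polyfun I" "b \<in> polyfun I"
    "\<And>x. p x = a (x(i := x i ^ 2)) + x i * b (x(i := x i ^ 2))"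
proof -
  have free_of_i: "g (x(i := c)) = g x" if "g \<in> polyfun (I - {i})" for g x c
    by (rule polyfun_upd_free[OF that]) simp
  have incl: "g \<in> polyfun I" if "g \<in> polyfun (I - {i})" for g
    using that by (rule polyfun_mono) blast
  have "\<exists>a \<in> polyfun I. \<exists>b \<in> polyfun I. \<forall>x. p x = a (x(i := x i ^ 2)) + x i * b (x(i := x i ^ 2))"
    using assms
  proof (induction rule: polyfun_Horner_induct)
    case (free g)
    then have "g x = g (x(i := x i ^ 2)) + x i * 0" for x by (simp add: free_of_i)
    then show ?case
      by (rule bexI[of _ g, OF bexI[of _ "\<lambda>x. 0", OF allI]]) (rule pf_const incl[OF free])+
  next
    case (Horner g q)
    then obtain a b where ab: "a \<in> polyfun I" "b \<in> polyfun I"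
      and q: "\<And>x. q x = a (x(i := x i ^ 2)) + x i * b (x(i := x i ^ 2))" by blast
    let ?a = "\<lambda>x. g x + x i * b x"
    have a: "?a \<in> polyfun I"
      by (intro pf_add pf_mult pf_var incl Horner(1) ab(2) \<open>i \<in> I\<close>)
    have "g x + x i * q x = ?a (x(i := x i ^ 2)) + x i * a (x(i := x i ^ 2))" for x
      unfolding q free_of_i[OF Horner(1)] by (simp add: algebra_simps power2_eq_square)
    then show ?case by (rule bexI[of _ ?a, OF bexI[of _ a, OF allI]]) (rule ab(1) a)+
  qed
  then show thesis using that by blast
qed

lemma polyfun_vanishing_on_codim_2:
  assumes p: "p \<in> polyfun I" and ij: "i \<in> I" "j \<in> I" "i \<noteq> j"
    and zero: "\<And>x. p (x(i := 0, j := 0)) = 0"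
  obtains b c where "b \<in> polyfun (I - {j})" "c \<in> polyfun I" "\<And>x. p x = x i * b x + x j * c x"
proof -
  obtain c where c: "c \<in> polyfun I" "\<And>x. p x = p (x(j := 0)) + x j * c x"
    by (rule polyfun_split_var[OF p ij(2)]) (rule that)
  have "i \<in> I - {j}" using ij by blast
  then obtain b where b: "b \<in> polyfun (I - {j})"
    "\<And>x. p (x(j := 0)) = p (x(i := 0, j := 0)) + x i * b x"
    by (rule polyfun_split_var[OF polyfun_fix_var[OF p, of j 0]]) (rule that)
  have "p x = x i * b x + x j * c x" for x
    using c(2)[of x] b(2)[of x] zero[of x] by simp
  with b(1) c(1) show thesis by (rule that)
qed

lemma polyfun_along_curve:
  assumes "p \<in> polyfun I"
  shows "\<exists>r. \<forall>s. p (\<lambda>i. poly (c i) s) = poly r s"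
  using assms
proof induction
  case (pf_const a)
  show ?case by (rule exI[of _ "[:a:]"]) simp
next
  case (pf_var i)
  show ?case by blast
next
  case (pf_add p q)
  then show ?case by (metis poly_add)
next
  case (pf_mult p q)
  then show ?case by (metis poly_mult)
qed

lemma polyfun_eq_0_if_eq_0_off_zeros:
  assumes p: "p \<in> polyfun I" and q: "q \<in> polyfun J"
    and off: "\<And>x. q x \<noteq> 0 \<Longrightarrow> p x = 0" and b: "q b \<noteq> 0"
  shows "p a = 0"
proof -
  define c where "c i = [:a i, b i - a i:]" for i
  obtain r s where r: "\<And>u. p (\<lambda>i. poly (c i) u) = poly r u"
    and s: "\<And>u. q (\<lambda>i. poly (c i) u) = poly s u"
    using polyfun_along_curve[OF p] polyfun_along_curve[OF q] by metis
  have "poly (r * s) u = 0" for u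
    using off[of "\<lambda>i. poly (c i) u"] by (auto simp: r s)
  then have "r * s = 0" using poly_all_0_iff_0 by blast
  moreover have "s \<noteq> 0" using b s[of 1] by (auto simp: c_def)
  ultimately have "r = 0" by simp
  then show ?thesis using r[of 0] by (simp add: c_def)
qed

lemma polyfun_eq_0_if_var_mult_eq_0:
  assumes "p \<in> polyfun I" and zero: "\<And>x. x i * p x = 0"
  shows "p a = 0"
proof (rule polyfun_eq_0_if_eq_0_off_zeros[OF assms(1) pf_var[of i UNIV]])
  show "p x = 0" if "x i \<noteq> 0" for x using zero[of x] that by simp
  show "(\<lambda>_. 1 :: complex) i \<noteq> 0" by simp
qed simp

lemma polyfun_directional_derivative:
  assumes "p \<in> polyfun I" "finite I"
  obtains l where "\<And>d. ((\<lambda>s. p (\<lambda>i. a i + s * d i)) has_field_derivative (\<Sum>i\<in>I. l i * d i)) (at 0)"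
proof -
  have "\<exists>l. \<forall>d. ((\<lambda>s. p (\<lambda>i. a i + s * d i)) has_field_derivative (\<Sum>i\<in>I. l i * d i)) (at 0)"
    (is "\<exists>l. ?gradient p l")
    using assms(1)
  proof induction
    case (pf_const c)
    show ?case by (rule exI[of _ "\<lambda>i. 0"]) simp
  next
    case (pf_var j)
    have "((\<lambda>s. a j + s * d j) has_field_derivative d j) (at 0)" for d
      by (auto intro!: derivative_eq_intros)
    moreover have "(\<Sum>i\<in>I. (if i = j then 1 else 0) * d i) = (\<Sum>i\<in>I. if i = j then d i else 0)"
      for d :: "'a \<Rightarrow> complex"
      by (rule sum.cong) auto
    ultimately show ?case using pf_var assms(2)
      by (intro exI[of _ "\<lambda>i. if i = j then 1 else 0"]) simp
  next
    case (pf_add p q)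
    then obtain l m where "?gradient p l" "?gradient q m" by blast
    from DERIV_add[OF this[rule_format], of d d for d] show ?case
      by (intro exI[of _ "\<lambda>i. l i + m i"]) (simp add: distrib_right sum.distrib)
  next
    case (pf_mult p q)
    then obtain l m where "?gradient p l" "?gradient q m" by blast
    from DERIV_mult[OF this[rule_format], of d d for d] show ?case
      by (intro exI[of _ "\<lambda>i. l i * q a + m i * p a"])
        (simp add: algebra_simps sum.distrib sum_distrib_left sum_distrib_right)
  qed
  then show thesis using that by blast
qed

lemma gen_subalg_image: "gen_subalg (f ` I) = (\<lambda>P x. P (\<lambda>i. f i x)) ` polyfun I"
proof (intro equalityI subsetI)
  fix p assume "p \<in> gen_subalg (f ` I)"
  then show "p \<in> (\<lambda>P x. P (\<lambda>i. f i x)) ` polyfun I"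
  proof induction
    case (ga_const c)
    show ?case by (rule image_eqI[OF _ pf_const]) rule
  next
    case (ga_gen g)
    then obtain i where "i \<in> I" "g = f i" by blast
    then show ?case by (intro image_eqI[OF _ pf_var]) auto
  next
    case (ga_add p q)
    then obtain P Q where "P \<in> polyfun I" "p = (\<lambda>x. P (\<lambda>i. f i x))"
      "Q \<in> polyfun I" "q = (\<lambda>x. Q (\<lambda>i. f i x))"
      by blast
    then show ?case by (intro image_eqI[OF _ pf_add[of P _ Q]]) auto
  next
    case (ga_mult p q)
    then obtain P Q where "P \<in> polyfun I" "p = (\<lambda>x. P (\<lambda>i. f i x))"
      "Q \<in> polyfun I" "q = (\<lambda>x. Q (\<lambda>i. f i x))"
      by blast
    then show ?case by (intro image_eqI[OF _ pf_mult[of P _ Q]]) auto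
  qed
next
  have "(\<lambda>x. P (\<lambda>i. f i x)) \<in> gen_subalg (f ` I)" if "P \<in> polyfun I" for P
    using that by induction (auto intro: gen_subalg.intros)
  then show "p \<in> gen_subalg (f ` I)" if "p \<in> (\<lambda>P x. P (\<lambda>i. f i x)) ` polyfun I" for p
    using that by blast
qed

section \<open>Three-by-three matrices\<close>

lemma less_3_iff: "i < 3 \<longleftrightarrow> i = 0 \<or> i = 1 \<or> i = (2::nat)"
  by auto

definition vec3 :: "'a \<Rightarrow> 'a \<Rightarrow> 'a \<Rightarrow> 'a vec" where
  "vec3 a b c = vec 3 (\<lambda>i. if i = 0 then a else if i = 1 then b else c)"

lemma vec3_carrier [simp]: "vec3 a b c \<in> carrier_vec 3"
  by (simp add: vec3_def)

lemma dim_vec3 [simp]: "dim_vec (vec3 a b c) = 3"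
  by (simp add: vec3_def)

lemma index_vec3 [simp]:
  "vec3 a b c $ 0 = a" "vec3 a b c $ 1 = b" "vec3 a b c $ Suc 0 = b" "vec3 a b c $ 2 = c"
  by (simp_all add: vec3_def)

lemma vec3_eqI:
  "v \<in> carrier_vec 3 \<Longrightarrow> v $ 0 = a \<Longrightarrow> v $ 1 = b \<Longrightarrow> v $ 2 = c \<Longrightarrow> v = vec3 a b c"
  by (rule eq_vecI) (auto simp: less_3_iff vec3_def)

lemma vec3_components: "v \<in> carrier_vec 3 \<Longrightarrow> vec3 (v $ 0) (v $ 1) (v $ 2) = v"
  by (rule vec3_eqI[symmetric]) simp_all

lemma scalar_prod_3:
  "w \<in> carrier_vec 3 \<Longrightarrow> v \<bullet> w = v $ 0 * w $ 0 + v $ 1 * w $ 1 + v $ 2 * w $ 2"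
  by (simp add: scalar_prod_def numeral_3_eq_3 numeral_2_eq_2)

lemma mult_mat_vec_3:
  assumes "A \<in> carrier_mat 3 3" "v \<in> carrier_vec 3" "i < 3"
  shows "(A *\<^sub>v v) $ i = A $$ (i,0) * v $ 0 + A $$ (i,1) * v $ 1 + A $$ (i,2) * v $ 2"
  using assms by (simp add: scalar_prod_3)

lemma mult_mat_3:
  assumes "A \<in> carrier_mat 3 3" "B \<in> carrier_mat 3 3" "i < 3" "j < 3"
  shows "(A * B) $$ (i,j) =
    A $$ (i,0) * B $$ (0,j) + A $$ (i,1) * B $$ (1,j) + A $$ (i,2) * B $$ (2,j)"
proof -
  have "col B j \<in> carrier_vec 3" using assms by auto
  then show ?thesis using assms by (simp add: scalar_prod_3)
qed

lemma tr_3: "A \<in> carrier_mat 3 3 \<Longrightarrow> tr A = A $$ (0,0) + A $$ (1,1) + A $$ (2,2)"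
  by (simp add: tr_def numeral_3_eq_3 numeral_2_eq_2)

lemma det_2:
  fixes A :: "'a :: comm_ring_1 mat"
  assumes A: "A \<in> carrier_mat 2 2"
  shows "det A = A $$ (0,0) * A $$ (1,1) - A $$ (0,1) * A $$ (1,0)"
proof -
  have "mat_delete A 0 j \<in> carrier_mat 1 1" for j
    using A by (auto simp: mat_delete_def)
  then show ?thesis
    using laplace_expansion_row[OF A, of 0] A
    by (simp add: cofactor_def det_single numeral_2_eq_2 mat_delete_def)
qed

lemma cofactor_3:
  fixes A :: "'a :: comm_ring_1 mat"
  assumes A: "A \<in> carrier_mat 3 3"
  shows "cofactor A i j = (- 1) ^ (i + j) *
    (mat_delete A i j $$ (0,0) * mat_delete A i j $$ (1,1)
      - mat_delete A i j $$ (0,1) * mat_delete A i j $$ (1,0))"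
proof -
  have "mat_delete A i j \<in> carrier_mat 2 2" using A by (auto simp: mat_delete_def)
  then show ?thesis by (simp add: cofactor_def det_2)
qed

lemma det_3:
  fixes A :: "'a :: comm_ring_1 mat"
  assumes A: "A \<in> carrier_mat 3 3"
  shows "det A = A $$ (0,0) * (A $$ (1,1) * A $$ (2,2) - A $$ (1,2) * A $$ (2,1))
    - A $$ (0,1) * (A $$ (1,0) * A $$ (2,2) - A $$ (1,2) * A $$ (2,0))
    + A $$ (0,2) * (A $$ (1,0) * A $$ (2,1) - A $$ (1,1) * A $$ (2,0))"
  using laplace_expansion_row[OF A, of 0] A
  by (simp add: cofactor_3 lessThan_nat_numeral lessThan_Suc numeral_2_eq_2 numeral_3_eq_3)
    (simp add: mat_delete_def algebra_simps)

lemma adj_mat_3: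
  assumes A: "A \<in> carrier_mat 3 3"
  defines "e \<equiv> A $$ (0,0) * A $$ (1,1) - A $$ (0,1) * A $$ (1,0)
    + A $$ (0,0) * A $$ (2,2) - A $$ (0,2) * A $$ (2,0)
    + A $$ (1,1) * A $$ (2,2) - A $$ (1,2) * A $$ (2,1)"
  shows "adj_mat A = e \<cdot>\<^sub>m 1\<^sub>m 3 + A * (- tr A \<cdot>\<^sub>m 1\<^sub>m 3 + A)"
proof (rule eq_matI)
  fix i j
  let ?B = "- tr A \<cdot>\<^sub>m 1\<^sub>m 3 + A"
  assume "i < dim_row (e \<cdot>\<^sub>m 1\<^sub>m 3 + A * ?B)" "j < dim_col (e \<cdot>\<^sub>m 1\<^sub>m 3 + A * ?B)"
  then have ij: "i < 3" "j < 3" using A by auto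
  have B: "?B \<in> carrier_mat 3 3" using A by simp
  have "(e \<cdot>\<^sub>m 1\<^sub>m 3 + A * ?B) $$ (i,j) = (A * ?B) $$ (i,j) + (if i = j then e else 0)"
    using A ij by simp
  also have "(A * ?B) $$ (i,j) = A $$ (i,0) * A $$ (0,j) + A $$ (i,1) * A $$ (1,j)
      + A $$ (i,2) * A $$ (2,j) - tr A * A $$ (i,j)"
    unfolding mult_mat_3[OF A B ij] using ij A by (auto simp: less_3_iff algebra_simps)
  also have "\<dots> + (if i = j then e else 0) = cofactor A j i"
    using ij A unfolding cofactor_3[OF A] less_3_iff tr_3[OF A] e_def
    by (elim disjE) (simp_all add: mat_delete_def algebra_simps numeral_2_eq_2)
  also have "\<dots> = adj_mat A $$ (i,j)"
    using ij A by (simp add: adj_mat_def)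
  finally show "adj_mat A $$ (i,j) = (e \<cdot>\<^sub>m 1\<^sub>m 3 + A * ?B) $$ (i,j)" ..
qed (use A in \<open>auto simp: adj_mat_def\<close>)

section \<open>Matrices with minimal polynomial of degree at most two\<close>

lemma one_smult_mat: "(1 :: 'a :: semiring_1) \<cdot>\<^sub>m A = A"
  by (rule eq_matI) auto

lemma mat_poly_eval_0: "mat_poly_eval 0 A = 0\<^sub>m (dim_row A) (dim_row A)"
  by (simp add: mat_poly_eval_def)

lemma mat_poly_eval_pCons:
  assumes "A \<in> carrier_mat n n"
  shows "mat_poly_eval (pCons c p) A = c \<cdot>\<^sub>m 1\<^sub>m n + A * mat_poly_eval p A"
proof (cases "p = 0 \<and> c = 0")
  case True
  with assms show ?thesis by (auto simp: mat_poly_eval_0)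
next
  case False
  then have "coeffs (pCons c p) = c # coeffs p" by (auto simp: cCons_def)
  with assms show ?thesis by (simp add: mat_poly_eval_def)
qed

lemma Cayley_Hamilton_3:
  assumes A: "A \<in> carrier_mat 3 3"
  shows "\<exists>p. lead_coeff p = 1 \<and> mat_poly_eval p A = 0\<^sub>m 3 3"
proof -
  obtain e where adj: "adj_mat A = e \<cdot>\<^sub>m 1\<^sub>m 3 + A * (- tr A \<cdot>\<^sub>m 1\<^sub>m 3 + A)"
    using adj_mat_3[OF A] by blast
  have "mat_poly_eval [: - det A, e, - tr A, 1 :] A = - det A \<cdot>\<^sub>m 1\<^sub>m 3 + A * adj_mat A"
    using A by (simp add: mat_poly_eval_pCons[OF A] mat_poly_eval_0 one_smult_mat adj)
  also have "\<dots> = 0\<^sub>m 3 3"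
    unfolding adj_mat(2)[OF A] by (rule eq_matI) auto
  finally show ?thesis by (intro exI[of _ "[: - det A, e, - tr A, 1 :]"]) simp
qed

lemma minpoly_degree_le_iff:
  assumes A: "A \<in> carrier_mat 3 3"
  shows "minpoly_degree A \<le> n \<longleftrightarrow>
    (\<exists>p. lead_coeff p = 1 \<and> degree p = n \<and> mat_poly_eval p A = 0\<^sub>m 3 3)"
    (is "_ \<longleftrightarrow> ?annihilated n")
proof
  have minpoly: "minpoly_degree A = (LEAST n. ?annihilated n)"
    using A by (simp add: minpoly_degree_def)
  show "minpoly_degree A \<le> n" if "?annihilated n"
    unfolding minpoly using that by (rule Least_le)
  have "\<exists>n. ?annihilated n" using Cayley_Hamilton_3[OF A] by blast
  then have "?annihilated (LEAST n. ?annihilated n)" by (rule LeastI_ex)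
  then have least: "?annihilated (minpoly_degree A)" unfolding minpoly .
  assume "minpoly_degree A \<le> n"
  then show "?annihilated n"
  proof (induction rule: dec_induct)
    case base
    show ?case by (rule least)
  next
    case (step n)
    then obtain p where "lead_coeff p = 1" "degree p = n" "mat_poly_eval p A = 0\<^sub>m 3 3" by blast
    moreover from this have "p \<noteq> 0" by auto
    ultimately show ?case
      using A by (intro exI[of _ "pCons 0 p"]) (auto simp: mat_poly_eval_pCons[OF A])
  qed
qed

lemma scalar_shift_mult:
  fixes A :: "'a :: comm_ring_1 mat"
  assumes "A \<in> carrier_mat n n" "B \<in> carrier_mat n n"
  shows "(c \<cdot>\<^sub>m 1\<^sub>m n + A) * B = c \<cdot>\<^sub>m B + A * B"
  using assms mult_smult_assoc_mat[OF one_carrier_mat assms(2)]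
  by (simp add: add_mult_distrib_mat[OF _ assms])

lemma mult_scalar_shift:
  fixes A :: "'a :: comm_ring_1 mat"
  assumes "A \<in> carrier_mat n n" "B \<in> carrier_mat n n"
  shows "B * (c \<cdot>\<^sub>m 1\<^sub>m n + A) = c \<cdot>\<^sub>m B + B * A"
  using assms mult_smult_distrib[OF assms(2) one_carrier_mat]
  by (simp add: mult_add_distrib_mat[OF assms(2) _ assms(1)])

lemma mult_scalar_shifts:
  fixes A :: "'a :: comm_ring_1 mat"
  assumes A: "A \<in> carrier_mat n n"
  shows "(a \<cdot>\<^sub>m 1\<^sub>m n + A) * (b \<cdot>\<^sub>m 1\<^sub>m n + A) = (a * b) \<cdot>\<^sub>m 1\<^sub>m n + A * ((a + b) \<cdot>\<^sub>m 1\<^sub>m n + A)"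
proof -
  have "(a \<cdot>\<^sub>m 1\<^sub>m n + A) * (b \<cdot>\<^sub>m 1\<^sub>m n + A)
    = a \<cdot>\<^sub>m (b \<cdot>\<^sub>m 1\<^sub>m n + A) + (b \<cdot>\<^sub>m A + A * A)"
    using A by (simp add: scalar_shift_mult[OF A, of "b \<cdot>\<^sub>m 1\<^sub>m n + A"] mult_scalar_shift[OF A A])
  also have "\<dots> = (a * b) \<cdot>\<^sub>m 1\<^sub>m n + ((a + b) \<cdot>\<^sub>m A + A * A)"
    using A by (intro eq_matI) (auto simp: algebra_simps)
  also have "\<dots> = (a * b) \<cdot>\<^sub>m 1\<^sub>m n + A * ((a + b) \<cdot>\<^sub>m 1\<^sub>m n + A)"
    using A by (simp add: mult_scalar_shift)
  finally show ?thesis .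
qed

lemma M1_iff_quadratic:
  "A \<in> M1 \<longleftrightarrow> A \<in> carrier_mat 3 3 \<and> (\<exists>r s. (r \<cdot>\<^sub>m 1\<^sub>m 3 + A) * (s \<cdot>\<^sub>m 1\<^sub>m 3 + A) = 0\<^sub>m 3 3)"
proof -
  have quadratic: "mat_poly_eval [:r * s, r + s, 1:] A = (r \<cdot>\<^sub>m 1\<^sub>m 3 + A) * (s \<cdot>\<^sub>m 1\<^sub>m 3 + A)"
    if A: "A \<in> carrier_mat 3 3" for r s
    using A
    by (simp add: mat_poly_eval_pCons[OF A] mat_poly_eval_0 one_smult_mat mult_scalar_shifts)
  have "(\<exists>p. lead_coeff p = 1 \<and> degree p = 2 \<and> mat_poly_eval p A = 0\<^sub>m 3 3) \<longleftrightarrow>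
      (\<exists>r s. (r \<cdot>\<^sub>m 1\<^sub>m 3 + A) * (s \<cdot>\<^sub>m 1\<^sub>m 3 + A) = 0\<^sub>m 3 3)" (is "?L \<longleftrightarrow> ?R")
    if A: "A \<in> carrier_mat 3 3"
  proof
    assume ?L
    then obtain p where p: "lead_coeff p = 1" "degree p = 2" "mat_poly_eval p A = 0\<^sub>m 3 3" by blast
    let ?a = "coeff p 0" and ?b = "coeff p 1"
    define r s where "r = (?b + csqrt (?b ^ 2 - 4 * ?a)) / 2"
      and "s = (?b - csqrt (?b ^ 2 - 4 * ?a)) / 2"
    have "r + s = ?b" "r * s = ?a"
      by (simp_all add: r_def s_def field_simps flip: power2_eq_square)
    then have "p = [:r * s, r + s, 1:]"
      using p(1,2)
      by (intro poly_eqI) (auto simp: coeff_pCons numeral_2_eq_2 coeff_eq_0 split: nat.split)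
    with p(3) quadratic[OF A] show ?R by metis
  next
    assume ?R
    then obtain r s where "(r \<cdot>\<^sub>m 1\<^sub>m 3 + A) * (s \<cdot>\<^sub>m 1\<^sub>m 3 + A) = 0\<^sub>m 3 3" by blast
    then show ?L
      by (intro exI[of _ "[:r * s, r + s, 1:]"]) (simp add: quadratic[OF A])
  qed
  then show ?thesis by (auto simp: M1_def minpoly_degree_le_iff)
qed

definition outer_prod :: "'a :: times vec \<Rightarrow> 'a vec \<Rightarrow> 'a mat" where
  "outer_prod v w = mat (dim_vec v) (dim_vec w) (\<lambda>(i,j). v $ i * w $ j)"

lemma index_outer_prod [simp]:
  "i < dim_vec v \<Longrightarrow> j < dim_vec w \<Longrightarrow> outer_prod v w $$ (i,j) = v $ i * w $ j"
  "dim_row (outer_prod v w) = dim_vec v" "dim_col (outer_prod v w) = dim_vec w"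
  by (simp_all add: outer_prod_def)

lemma outer_prod_carrier [simp]:
  "v \<in> carrier_vec m \<Longrightarrow> w \<in> carrier_vec n \<Longrightarrow> outer_prod v w \<in> carrier_mat m n"
  by (simp add: outer_prod_def)

lemma mult_outer_prod:
  fixes A :: "'a :: comm_semiring_0 mat"
  assumes "A \<in> carrier_mat m n" "v \<in> carrier_vec n"
  shows "A * outer_prod v w = outer_prod (A *\<^sub>v v) w"
  using assms by (intro eq_matI) (auto simp: scalar_prod_def sum_distrib_right mult.assoc)

lemma outer_prod_mult:
  fixes A :: "'a :: comm_semiring_0 mat"
  assumes "w \<in> carrier_vec m" "A \<in> carrier_mat m n"
  shows "outer_prod v w * A = outer_prod v (A\<^sup>T *\<^sub>v w)"
  using assms by (intro eq_matI) (auto simp: scalar_prod_def sum_distrib_left mult_ac)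

lemma outer_prod_mult_outer_prod:
  fixes w :: "'a :: comm_semiring_0 vec"
  assumes "w \<in> carrier_vec n" "v' \<in> carrier_vec n"
  shows "outer_prod v w * outer_prod v' w' = (w \<bullet> v') \<cdot>\<^sub>m outer_prod v w'"
  using assms by (intro eq_matI) (auto simp: scalar_prod_def sum_distrib_left mult_ac)

lemma outer_prod_mult_scalar_shift:
  fixes v w :: "'a :: comm_ring_1 vec"
  assumes "v \<in> carrier_vec n" "w \<in> carrier_vec n"
  shows "outer_prod v w * (c \<cdot>\<^sub>m 1\<^sub>m n + outer_prod v w) = (c + v \<bullet> w) \<cdot>\<^sub>m outer_prod v w"
  using assms comm_scalar_prod[OF assms]
  by (simp add: mult_scalar_shift outer_prod_mult_outer_prod
      add_smult_distrib_right_mat[OF outer_prod_carrier[OF assms]])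

lemma outer_prod_of_minors_eq_0:
  fixes A :: "'a :: field mat"
  assumes A: "A \<in> carrier_mat m n"
    and minors: "\<And>i i' j j'. i < m \<Longrightarrow> i' < m \<Longrightarrow> j < n \<Longrightarrow> j' < n \<Longrightarrow>
      A $$ (i,j) * A $$ (i',j') = A $$ (i,j') * A $$ (i',j)"
  shows "\<exists>v \<in> carrier_vec m. \<exists>w \<in> carrier_vec n. A = outer_prod v w"
proof (cases "\<exists>a<m. \<exists>b<n. A $$ (a,b) \<noteq> 0")
  case True
  then obtain a b where ab: "a < m" "b < n" "A $$ (a,b) \<noteq> 0" by blast
  have "A $$ (i,j) = A $$ (i,b) * (A $$ (a,j) / A $$ (a,b))" if "i < m" "j < n" for i j
    using minors[OF that(1) ab(1) that(2) ab(2)] ab(3) by (simp add: field_simps)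
  then have "A = outer_prod (vec m (\<lambda>i. A $$ (i,b))) (vec n (\<lambda>j. A $$ (a,j) / A $$ (a,b)))"
    using A by (intro eq_matI) auto
  then show ?thesis by (metis vec_carrier)
next
  case False
  with A have "A = outer_prod (0\<^sub>v m) (0\<^sub>v n)" by (intro eq_matI) auto
  then show ?thesis by (metis zero_carrier_vec)
qed

definition cross_prod :: "'a :: comm_ring_1 vec \<Rightarrow> 'a vec \<Rightarrow> 'a vec" where
  "cross_prod c d = vec3 (c $ 1 * d $ 2 - c $ 2 * d $ 1) (c $ 2 * d $ 0 - c $ 0 * d $ 2)
     (c $ 0 * d $ 1 - c $ 1 * d $ 0)"

lemma cross_prod_eq_0_imp_minors_eq_0:
  assumes "\<And>k. k < 3 \<Longrightarrow> cross_prod c d $ k = 0" "i < 3" "j < 3"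
  shows "c $ i * d $ j = c $ j * d $ i"
  using assms(1)[of 0] assms(1)[of 1] assms(1)[of 2] assms(2,3)
  by (auto simp: cross_prod_def less_3_iff mult.commute)

lemma orthogonal_proportional_to_cross_prod:
  assumes "c \<in> carrier_vec 3" "d \<in> carrier_vec 3" "u \<bullet> c = 0" "u \<bullet> d = 0" "i < 3" "j < 3"
  shows "u $ i * cross_prod c d $ j = u $ j * cross_prod c d $ i"
proof -
  have "u $ 0 * cross_prod c d $ 1 - u $ 1 * cross_prod c d $ 0 = c $ 2 * (u \<bullet> d) - d $ 2 * (u \<bullet> c)"
    "u $ 0 * cross_prod c d $ 2 - u $ 2 * cross_prod c d $ 0 = d $ 1 * (u \<bullet> c) - c $ 1 * (u \<bullet> d)"
    "u $ 1 * cross_prod c d $ 2 - u $ 2 * cross_prod c d $ 1 = c $ 0 * (u \<bullet> d) - d $ 0 * (u \<bullet> c)"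
    using assms(1,2) by (simp_all add: cross_prod_def scalar_prod_3 algebra_simps)
  with assms(3-) show ?thesis by (auto simp: less_3_iff)
qed

text \<open>Independent columns of \<open>C\<close> force every row of \<open>B\<close> to be a multiple of their cross product.\<close>

lemma outer_prod_of_mult_eq_0:
  fixes B C :: "'a :: field mat"
  assumes B: "B \<in> carrier_mat 3 3" and C: "C \<in> carrier_mat 3 3" and BC: "B * C = 0\<^sub>m 3 3"
  shows "\<exists>v \<in> carrier_vec 3. \<exists>w \<in> carrier_vec 3. B = outer_prod v w \<or> C = outer_prod v w"
proof (cases "\<exists>b<3. \<exists>b'<3. \<exists>k<3. cross_prod (col C b) (col C b') $ k \<noteq> 0")
  case True
  then obtain b b' k where b: "b < 3" "b' < 3"
    and k: "k < 3" "cross_prod (col C b) (col C b') $ k \<noteq> 0"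
    by blast
  define n where "n = cross_prod (col C b) (col C b')"
  have n: "n \<in> carrier_vec 3" by (simp add: n_def cross_prod_def)
  have "B $$ (i,j) = B $$ (i,k) / n $ k * n $ j" if "i < 3" "j < 3" for i j
  proof -
    have orthogonal: "row B i \<bullet> col C l = 0" if "l < 3" for l
      using arg_cong[OF BC, of "\<lambda>M. M $$ (i,l)"] that \<open>i < 3\<close> B C by simp
    have "row B i $ j * n $ k = row B i $ k * n $ j"
      unfolding n_def using C b that k(1)
      by (intro orthogonal_proportional_to_cross_prod orthogonal) auto
    then show ?thesis using B that k by (simp add: n_def field_simps)
  qed
  then have "B = outer_prod (vec 3 (\<lambda>i. B $$ (i,k) / n $ k)) n"
    using B n by (intro eq_matI) auto
  with n show ?thesis by (metis vec_carrier)
next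
  case False
  have "C $$ (i,j) * C $$ (i',j') = C $$ (i,j') * C $$ (i',j)"
    if "i < 3" "i' < 3" "j < 3" "j' < 3" for i i' j j'
    using cross_prod_eq_0_imp_minors_eq_0[of "col C j" "col C j'" i i'] False that C
    by (simp add: mult.commute)
  then show ?thesis using outer_prod_of_minors_eq_0[OF C] by blast
qed

definition outer_with_trace :: "complex \<Rightarrow> complex vec \<Rightarrow> complex vec \<Rightarrow> complex mat" where
  "outer_with_trace t v w = ((t - v \<bullet> w) / 3) \<cdot>\<^sub>m 1\<^sub>m 3 + outer_prod v w"

lemma outer_with_trace_carrier [simp]:
  "v \<in> carrier_vec 3 \<Longrightarrow> w \<in> carrier_vec 3 \<Longrightarrow> outer_with_trace t v w \<in> carrier_mat 3 3"
  by (simp add: outer_with_trace_def)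

lemma index_outer_with_trace:
  assumes "v \<in> carrier_vec 3" "w \<in> carrier_vec 3" "i < 3" "j < 3"
  shows "outer_with_trace t v w $$ (i,j) = v $ i * w $ j + (if i = j then (t - v \<bullet> w) / 3 else 0)"
  using assms by (simp add: outer_with_trace_def)

lemma tr_outer_with_trace:
  assumes "v \<in> carrier_vec 3" "w \<in> carrier_vec 3"
  shows "tr (outer_with_trace t v w) = t"
  using assms by (simp add: tr_3 index_outer_with_trace scalar_prod_3 field_simps)

lemma c1_outer_with_trace:
  assumes "v \<in> carrier_vec 3" "w \<in> carrier_vec 3"
  shows "c1 (outer_with_trace t v w) = outer_with_trace 0 v w"
proof -
  have "c1 (outer_with_trace t v w) = outer_with_trace t v w - (t / 3) \<cdot>\<^sub>m 1\<^sub>m 3"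
    by (simp add: c1_def tr_outer_with_trace assms)
  also have "\<dots> = outer_with_trace 0 v w"
    using assms unfolding outer_with_trace_def by (intro eq_matI) (auto simp: diff_divide_distrib)
  finally show ?thesis .
qed

lemma M1_iff_outer_with_trace:
  "A \<in> M1 \<longleftrightarrow> (\<exists>t. \<exists>v \<in> carrier_vec 3. \<exists>w \<in> carrier_vec 3. A = outer_with_trace t v w)"
proof
  assume "A \<in> M1"
  then obtain r s where A: "A \<in> carrier_mat 3 3"
    and "(r \<cdot>\<^sub>m 1\<^sub>m 3 + A) * (s \<cdot>\<^sub>m 1\<^sub>m 3 + A) = 0\<^sub>m 3 3"
    unfolding M1_iff_quadratic by blast
  then obtain c v w where vw: "v \<in> carrier_vec 3" "w \<in> carrier_vec 3"
    and "c \<cdot>\<^sub>m 1\<^sub>m 3 + A = outer_prod v w"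
    using outer_prod_of_mult_eq_0[of "r \<cdot>\<^sub>m 1\<^sub>m 3 + A" "s \<cdot>\<^sub>m 1\<^sub>m 3 + A"] by auto
  then have "(c \<cdot>\<^sub>m 1\<^sub>m 3 + A) $$ (i,j) = v $ i * w $ j" if "i < 3" "j < 3" for i j
    using that by simp
  then have "A = outer_with_trace (v \<bullet> w - 3 * c) v w"
    using A vw unfolding outer_with_trace_def by (intro eq_matI) (auto simp: eq_diff_eq add.commute)
  with vw show "\<exists>t. \<exists>v \<in> carrier_vec 3. \<exists>w \<in> carrier_vec 3. A = outer_with_trace t v w" by blast
next
  assume "\<exists>t. \<exists>v \<in> carrier_vec 3. \<exists>w \<in> carrier_vec 3. A = outer_with_trace t v w"
  then obtain t v w where vw: "v \<in> carrier_vec 3" "w \<in> carrier_vec 3"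
    and A: "A = outer_with_trace t v w"
    by blast
  define m where "m = (t - v \<bullet> w) / 3"
  have "- m \<cdot>\<^sub>m 1\<^sub>m 3 + A = outer_prod v w"
    "(- m - v \<bullet> w) \<cdot>\<^sub>m 1\<^sub>m 3 + A = (- (v \<bullet> w)) \<cdot>\<^sub>m 1\<^sub>m 3 + outer_prod v w"
    using vw unfolding A outer_with_trace_def m_def by (auto intro!: eq_matI)
  then have "(- m \<cdot>\<^sub>m 1\<^sub>m 3 + A) * ((- m - v \<bullet> w) \<cdot>\<^sub>m 1\<^sub>m 3 + A) = 0 \<cdot>\<^sub>m outer_prod v w"
    using vw by (simp add: outer_prod_mult_scalar_shift)
  also have "\<dots> = 0\<^sub>m 3 3" using vw by (intro eq_matI) auto
  finally show "A \<in> M1" unfolding M1_iff_quadratic using A vw by auto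
qed

lemma M1E:
  assumes "A \<in> M1"
  obtains t v w where "v \<in> carrier_vec 3" "w \<in> carrier_vec 3" "A = outer_with_trace t v w"
  using assms unfolding M1_iff_outer_with_trace by blast

lemma outer_with_trace_in_M1:
  "v \<in> carrier_vec 3 \<Longrightarrow> w \<in> carrier_vec 3 \<Longrightarrow> outer_with_trace t v w \<in> M1"
  unfolding M1_iff_outer_with_trace by blast

lemma N1E:
  assumes "A \<in> N1"
  obtains v w where "v \<in> carrier_vec 3" "w \<in> carrier_vec 3" "A = outer_with_trace 0 v w"
proof -
  have "A \<in> M1" "tr A = 0" using assms by (simp_all add: N1_def)
  then show thesis using that by (metis M1E tr_outer_with_trace)
qed

lemma outer_with_trace_in_N1:
  "v \<in> carrier_vec 3 \<Longrightarrow> w \<in> carrier_vec 3 \<Longrightarrow> outer_with_trace 0 v w \<in> N1"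
  by (simp add: N1_def outer_with_trace_in_M1 tr_outer_with_trace)

lemma N1_subset_M1: "N1 \<subseteq> M1"
  by (auto simp: N1_def)

lemma c1_in_N1: "A \<in> M1 \<Longrightarrow> c1 A \<in> N1"
  by (metis M1E c1_outer_with_trace outer_with_trace_in_N1)

lemma c1_on_N1: "A \<in> N1 \<Longrightarrow> c1 A = A"
  by (metis N1E c1_outer_with_trace)

lemma outer_with_trace_0_square:
  assumes "v \<in> carrier_vec 3" "w \<in> carrier_vec 3"
  defines "z \<equiv> v \<bullet> w / 3"
  shows "outer_with_trace 0 v w * outer_with_trace 0 v w = z ^ 2 \<cdot>\<^sub>m 1\<^sub>m 3 + z \<cdot>\<^sub>m outer_prod v w"
proof -
  have "outer_with_trace 0 v w = - z \<cdot>\<^sub>m 1\<^sub>m 3 + outer_prod v w"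
    by (simp add: outer_with_trace_def z_def)
  then have "outer_with_trace 0 v w * outer_with_trace 0 v w
    = (- z * - z) \<cdot>\<^sub>m 1\<^sub>m 3 + outer_prod v w * ((- z + - z) \<cdot>\<^sub>m 1\<^sub>m 3 + outer_prod v w)"
    using assms by (simp only: mult_scalar_shifts[OF outer_prod_carrier])
  also have "\<dots> = z ^ 2 \<cdot>\<^sub>m 1\<^sub>m 3 + ((- z + - z) + v \<bullet> w) \<cdot>\<^sub>m outer_prod v w"
    using assms by (simp only: outer_prod_mult_scalar_shift power2_eq_square minus_mult_minus)
  also have "(- z + - z) + v \<bullet> w = z" by (simp add: z_def)
  finally show ?thesis .
qed

lemma covariants_outer_with_trace:
  assumes "v \<in> carrier_vec 3" "w \<in> carrier_vec 3"
  defines "z \<equiv> v \<bullet> w / 3"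
  shows "d1 (outer_with_trace t v w) = t" "d2 (outer_with_trace t v w) = z ^ 2"
    "d3 (outer_with_trace t v w) = z ^ 3" "c1U (outer_with_trace t v w) = v $ 2 * w $ 0"
    "c2U (outer_with_trace t v w) = z * (v $ 2 * w $ 0)"
proof -
  note c1 = c1_outer_with_trace[OF assms(1,2), of t]
    and square = outer_with_trace_0_square[OF assms(1,2), folded z_def]
  have z: "v $ 0 * w $ 0 = 3 * z - v $ 1 * w $ 1 - v $ 2 * w $ 2"
    using scalar_prod_3[OF assms(2), of v] by (simp add: z_def field_simps)
  show "d1 (outer_with_trace t v w) = t" by (simp add: d1_def tr_outer_with_trace assms)
  have "tr (z ^ 2 \<cdot>\<^sub>m 1\<^sub>m 3 + z \<cdot>\<^sub>m outer_prod v w) = 6 * z ^ 2"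
    using assms(1,2) by (simp add: tr_3 z algebra_simps power2_eq_square)
  then show "d2 (outer_with_trace t v w) = z ^ 2"
    by (simp add: d2_def c1 square)
  have index: "outer_with_trace 0 v w $$ (i,j) = v $ i * w $ j - (if i = j then z else 0)"
    if "i < 3" "j < 3" for i j
    using assms that by (simp add: index_outer_with_trace)
  have "det (outer_with_trace 0 v w)
    = (v $ 0 * w $ 0 + v $ 1 * w $ 1 + v $ 2 * w $ 2) * z ^ 2 - z ^ 3"
    using det_3[OF outer_with_trace_carrier[OF assms(1,2)], of 0]
    by (simp add: index algebra_simps power2_eq_square power3_eq_cube)
  then show "d3 (outer_with_trace t v w) = z ^ 3"
    by (simp add: d3_def c1 z power2_eq_square power3_eq_cube)
  show "c1U (outer_with_trace t v w) = v $ 2 * w $ 0"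
    using assms by (simp add: c1U_def index_outer_with_trace)
  show "c2U (outer_with_trace t v w) = z * (v $ 2 * w $ 0)"
    using assms(1,2) by (simp add: c2U_def c1 square)
qed

section \<open>Conjugation\<close>

lemma scalar_prod_conj:
  fixes v w :: "'a :: field vec"
  assumes h: "h \<in> carrier_mat n n" and g: "g \<in> carrier_mat n n" and hg: "h * g = 1\<^sub>m n"
    and v: "v \<in> carrier_vec n" and w: "w \<in> carrier_vec n"
  shows "(h *\<^sub>v v) \<bullet> (g\<^sup>T *\<^sub>v w) = v \<bullet> w"
proof -
  have hv: "h *\<^sub>v v \<in> carrier_vec n" and gw: "g\<^sup>T *\<^sub>v w \<in> carrier_vec n"
    using h g v w by (auto intro: mult_mat_vec_carrier[of _ n n])
  have "(h *\<^sub>v v) \<bullet> (g\<^sup>T *\<^sub>v w) = (g\<^sup>T *\<^sub>v w) \<bullet> (h *\<^sub>v v)"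
    by (rule comm_scalar_prod[OF hv gw])
  also have "\<dots> = w \<bullet> (g * h *\<^sub>v v)"
    using assoc_mult_mat_vec[OF g h v] by (simp only: transpose_vec_mult_scalar[OF g hv w])
  also have "\<dots> = v \<bullet> w"
    using mat_mult_left_right_inverse[OF h g hg] v comm_scalar_prod[OF w v] by simp
  finally show ?thesis .
qed

lemma outer_with_trace_conj:
  assumes h: "h \<in> carrier_mat 3 3" and g: "g \<in> carrier_mat 3 3" and hg: "h * g = 1\<^sub>m 3"
    and v: "v \<in> carrier_vec 3" and w: "w \<in> carrier_vec 3"
  shows "h * outer_with_trace t v w * g = outer_with_trace t (h *\<^sub>v v) (g\<^sup>T *\<^sub>v w)"
proof -
  define m where "m = (t - v \<bullet> w) / 3"
  have "h * outer_with_trace t v w = m \<cdot>\<^sub>m h + outer_prod (h *\<^sub>v v) w"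
    using v w h by (simp add: outer_with_trace_def m_def mult_scalar_shift mult_outer_prod[OF h])
  also have "\<dots> * g = m \<cdot>\<^sub>m (h * g) + outer_prod (h *\<^sub>v v) w * g"
    using h g v w mult_smult_assoc_mat[OF h g]
    by (subst add_mult_distrib_mat[where nr = 3 and n = 3 and nc = 3]) auto
  also have "\<dots> = outer_with_trace t (h *\<^sub>v v) (g\<^sup>T *\<^sub>v w)"
    using scalar_prod_conj[OF h g hg v w]
    by (simp add: outer_with_trace_def m_def outer_prod_mult[OF w g] hg)
  finally show ?thesis .
qed

definition conj_closed :: "complex mat set \<Rightarrow> bool" where
  "conj_closed S \<longleftrightarrow> (\<forall>A \<in> S. \<forall>h \<in> carrier_mat 3 3. \<forall>g \<in> carrier_mat 3 3.
     h * g = 1\<^sub>m 3 \<longrightarrow> h * A * g \<in> S)"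

lemma conj_closedD:
  "conj_closed S \<Longrightarrow> A \<in> S \<Longrightarrow> h \<in> carrier_mat 3 3 \<Longrightarrow> g \<in> carrier_mat 3 3 \<Longrightarrow> h * g = 1\<^sub>m 3 \<Longrightarrow>
    h * A * g \<in> S"
  unfolding conj_closed_def by blast

lemma conj_closed_M1: "conj_closed M1"
  unfolding conj_closed_def
proof (intro ballI impI)
  fix A h g :: "complex mat"
  assume "A \<in> M1" and hg: "h \<in> carrier_mat 3 3" "g \<in> carrier_mat 3 3" "h * g = 1\<^sub>m 3"
  from \<open>A \<in> M1\<close> obtain t v w
    where "v \<in> carrier_vec 3" "w \<in> carrier_vec 3" "A = outer_with_trace t v w"
    by (rule M1E)
  with hg show "h * A * g \<in> M1"
    by (simp add: outer_with_trace_conj outer_with_trace_in_M1)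
qed

lemma c1_conj:
  assumes "A \<in> M1" "h \<in> carrier_mat 3 3" "g \<in> carrier_mat 3 3" "h * g = 1\<^sub>m 3"
  shows "c1 (h * A * g) = h * c1 A * g"
proof -
  from \<open>A \<in> M1\<close> obtain t v w
    where "v \<in> carrier_vec 3" "w \<in> carrier_vec 3" "A = outer_with_trace t v w"
    by (rule M1E)
  with assms show ?thesis by (simp add: outer_with_trace_conj c1_outer_with_trace)
qed

lemma conj_closed_N1: "conj_closed N1"
  unfolding conj_closed_def
proof (intro ballI impI)
  fix A h g :: "complex mat"
  assume A: "A \<in> N1" and hg: "h \<in> carrier_mat 3 3" "g \<in> carrier_mat 3 3" "h * g = 1\<^sub>m 3"
  then have "h * A * g \<in> M1"
    using N1_subset_M1 by (blast intro: conj_closedD[OF conj_closed_M1])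
  moreover have "c1 (h * A * g) = h * A * g"
    using A hg N1_subset_M1 by (simp add: c1_conj c1_on_N1 subset_iff)
  ultimately show "h * A * g \<in> N1" using c1_in_N1 by metis
qed

lemma conj_cancel:
  fixes A :: "'a :: field mat"
  assumes h: "h \<in> carrier_mat n n" and g: "g \<in> carrier_mat n n" and hg: "h * g = 1\<^sub>m n"
    and A: "A \<in> carrier_mat n n"
  shows "g * (h * A * g) * h = A"
proof -
  have gh: "g * h = 1\<^sub>m n" using mat_mult_left_right_inverse[OF h g hg] .
  have Ag: "A * g \<in> carrier_mat n n" using A g by simp
  have "g * (h * A * g) = g * h * (A * g)"
    by (simp only: assoc_mult_mat[OF h A g] assoc_mult_mat[OF g h Ag])
  also have "\<dots> = A * g" by (simp only: gh left_mult_one_mat[OF Ag])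
  finally show ?thesis by (simp only: assoc_mult_mat[OF A g h] gh right_mult_one_mat[OF A])
qed

lemma conj_closed_iff:
  assumes "conj_closed S" "h \<in> carrier_mat 3 3" "g \<in> carrier_mat 3 3" "h * g = 1\<^sub>m 3"
    and "A \<in> carrier_mat 3 3"
  shows "h * A * g \<in> S \<longleftrightarrow> A \<in> S"
  using assms conj_cancel[OF assms(2-5)] mat_mult_left_right_inverse[OF assms(2-4)]
  unfolding conj_closed_def by metis

definition unitriangular :: "complex \<Rightarrow> complex \<Rightarrow> complex \<Rightarrow> complex mat" where
  "unitriangular a b c = mat 3 3 (\<lambda>(i,j). if i = j then 1 else if (i,j) = (0,1) then a
     else if (i,j) = (0,2) then b else if (i,j) = (1,2) then c else 0)"

lemma unitriangular_carrier [simp]: "unitriangular a b c \<in> carrier_mat 3 3"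
  by (simp add: unitriangular_def)

lemma index_unitriangular:
  "unitriangular a b c $$ (0,0) = 1"
  "unitriangular a b c $$ (0,1) = a"
  "unitriangular a b c $$ (0,2) = b"
  "unitriangular a b c $$ (1,0) = 0"
  "unitriangular a b c $$ (1,1) = 1"
  "unitriangular a b c $$ (1,2) = c"
  "unitriangular a b c $$ (2,0) = 0"
  "unitriangular a b c $$ (2,1) = 0"
  "unitriangular a b c $$ (2,2) = 1"
  by (simp_all add: unitriangular_def)

lemma unitriangular_in_U3: "unitriangular a b c \<in> U3"
  by (auto simp: U3_def unitriangular_def)

lemma U3_carrier: "u \<in> U3 \<Longrightarrow> u \<in> carrier_mat 3 3"
  by (simp add: U3_def)

lemma U3_eq_unitriangular:
  assumes "u \<in> U3"
  shows "u = unitriangular (u $$ (0,1)) (u $$ (0,2)) (u $$ (1,2))"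
  using assms by (intro eq_matI) (auto simp: U3_def unitriangular_def less_3_iff)

lemma unitriangular_left_inverse:
  "unitriangular (- a) (a * c - b) (- c) * unitriangular a b c = 1\<^sub>m 3"
proof (rule eq_matI)
  fix i j assume "i < dim_row (1\<^sub>m 3 :: complex mat)" "j < dim_col (1\<^sub>m 3 :: complex mat)"
  then have ij: "i < 3" "j < 3" by simp_all
  then show "(unitriangular (- a) (a * c - b) (- c) * unitriangular a b c) $$ (i,j)
      = 1\<^sub>m 3 $$ (i,j)"
    unfolding mult_mat_3[OF unitriangular_carrier unitriangular_carrier ij]
    by (auto simp: less_3_iff index_unitriangular simp del: One_nat_def)
qed (simp_all add: unitriangular_def)

lemma left_inverse_unitriangular:
  assumes h: "h \<in> carrier_mat 3 3" and "h * unitriangular a b c = 1\<^sub>m 3"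
  shows "h = unitriangular (- a) (a * c - b) (- c)"
proof -
  let ?u = "unitriangular a b c" and ?i = "unitriangular (- a) (a * c - b) (- c)"
  have "?u * ?i = 1\<^sub>m 3"
    using mat_mult_left_right_inverse[OF _ _ unitriangular_left_inverse] by simp
  then have "h = h * (?u * ?i)" using h by simp
  also have "\<dots> = h * ?u * ?i" using h by (simp add: assoc_mult_mat[of _ 3 3 _ 3 _ 3])
  finally show ?thesis using assms(2) left_mult_one_mat[OF unitriangular_carrier] by simp
qed

lemma unitriangular_mult_vec:
  assumes "v \<in> carrier_vec 3"
  shows "unitriangular a b c *\<^sub>v v =
    vec3 (v $ 0 + a * v $ 1 + b * v $ 2) (v $ 1 + c * v $ 2) (v $ 2)"
  using mult_mat_vec_carrier[OF unitriangular_carrier assms]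
    mult_mat_vec_3[OF unitriangular_carrier assms]
  by (intro vec3_eqI) (simp_all only: index_unitriangular, simp_all)

lemma unitriangular_transpose_mult_vec:
  assumes "w \<in> carrier_vec 3"
  shows "(unitriangular a b c)\<^sup>T *\<^sub>v w =
    vec3 (w $ 0) (a * w $ 0 + w $ 1) (b * w $ 0 + c * w $ 1 + w $ 2)"
proof -
  have T: "(unitriangular a b c)\<^sup>T \<in> carrier_mat 3 3" by simp
  have index: "(unitriangular a b c)\<^sup>T $$ (i,j) = unitriangular a b c $$ (j,i)"
    if "i < 3" "j < 3" for i j
    using that by (simp add: unitriangular_def)
  show ?thesis
    using mult_mat_vec_carrier[OF T assms] mult_mat_vec_3[OF T assms]
    by (intro vec3_eqI)
      (simp_all add: index index_unitriangular
        del: One_nat_def index_mult_mat_vec index_transpose_mat)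
qed

definition slice :: "complex \<Rightarrow> complex \<Rightarrow> complex \<Rightarrow> complex mat" where
  "slice t z D = outer_with_trace t (vec3 0 0 1) (vec3 D 0 (3 * z))"

lemma slice_in_M1: "slice t z D \<in> M1"
  by (simp add: slice_def outer_with_trace_in_M1)

lemma slice_in_N1: "slice 0 z D \<in> N1"
  by (simp add: slice_def outer_with_trace_in_N1)

lemma conj_to_slice:
  assumes v: "v \<in> carrier_vec 3" and w: "w \<in> carrier_vec 3" and generic: "v $ 2 \<noteq> 0" "w $ 0 \<noteq> 0"
  obtains h u where "u \<in> U3" "h \<in> carrier_mat 3 3" "h * u = 1\<^sub>m 3"
    "h * outer_with_trace t v w * u = slice t (v \<bullet> w / 3) (v $ 2 * w $ 0)"
proof -
  define a b c where "a = - w $ 1 / w $ 0" and "b = v $ 0 / v $ 2" and "c = v $ 1 / v $ 2"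
  define h where "h = unitriangular (- a) (a * c - b) (- c)"
  define y where "y = b * w $ 0 + c * w $ 1 + w $ 2"
  have h: "h \<in> carrier_mat 3 3" and hu: "h * unitriangular a b c = 1\<^sub>m 3"
    by (simp_all add: h_def unitriangular_left_inverse)
  have "h *\<^sub>v v = vec3 0 0 (v $ 2)" "(unitriangular a b c)\<^sup>T *\<^sub>v w = vec3 (w $ 0) 0 y"
    using generic
    by (simp_all add: h_def unitriangular_mult_vec[OF v] unitriangular_transpose_mult_vec[OF w]
        a_def b_def c_def y_def field_simps)
  with scalar_prod_conj[OF h _ hu v w] outer_with_trace_conj[OF h _ hu v w]
  have conj: "h * outer_with_trace t v w * unitriangular a b c
      = outer_with_trace t (vec3 0 0 (v $ 2)) (vec3 (w $ 0) 0 y)"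
    and vw: "v \<bullet> w = v $ 2 * y"
    by (simp_all add: scalar_prod_3)
  have "outer_prod (vec3 0 0 (v $ 2)) (vec3 (w $ 0) 0 y)
      = outer_prod (vec3 0 0 1) (vec3 (v $ 2 * w $ 0) 0 (v $ 2 * y))"
    by (rule eq_matI) (auto simp: less_3_iff)
  then have "outer_with_trace t (vec3 0 0 (v $ 2)) (vec3 (w $ 0) 0 y)
      = slice t (v \<bullet> w / 3) (v $ 2 * w $ 0)"
    by (simp add: outer_with_trace_def slice_def vw scalar_prod_3)
  with h hu show thesis using that[OF unitriangular_in_U3 h hu] conj by simp
qed

section \<open>Invariants of the unipotent group\<close>

lemma mat_polyfunE:
  assumes "f \<in> mat_polyfun"
  obtains p where "p \<in> polyfun ({..<3} \<times> {..<3})"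
    "\<And>A. A \<in> carrier_mat 3 3 \<Longrightarrow> f A = p (\<lambda>ij. A $$ ij)"
  using assms by (auto simp: mat_polyfun_def)

lemma mat_polyfunI:
  "p \<in> polyfun ({..<3} \<times> {..<3}) \<Longrightarrow> (\<And>A. A \<in> carrier_mat 3 3 \<Longrightarrow> f A = p (\<lambda>ij. A $$ ij)) \<Longrightarrow>
    f \<in> mat_polyfun"
  by (auto simp: mat_polyfun_def)

lemma mat_polyfun_cong:
  "f \<in> mat_polyfun \<Longrightarrow> (\<And>A. A \<in> carrier_mat 3 3 \<Longrightarrow> g A = f A) \<Longrightarrow> g \<in> mat_polyfun"
  by (auto simp: mat_polyfun_def)

lemma mat_polyfun_const: "(\<lambda>A. c) \<in> mat_polyfun"
  by (rule mat_polyfunI[OF pf_const]) rule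

lemma mat_polyfun_entry: "i < 3 \<Longrightarrow> j < 3 \<Longrightarrow> (\<lambda>A. A $$ (i,j)) \<in> mat_polyfun"
  by (rule mat_polyfunI[OF pf_var]) auto

lemma mat_polyfun_add:
  assumes "f \<in> mat_polyfun" "g \<in> mat_polyfun"
  shows "(\<lambda>A. f A + g A) \<in> mat_polyfun"
  using assms by (elim mat_polyfunE) (rule mat_polyfunI[OF pf_add], auto)

lemma mat_polyfun_mult:
  assumes "f \<in> mat_polyfun" "g \<in> mat_polyfun"
  shows "(\<lambda>A. f A * g A) \<in> mat_polyfun"
  using assms by (elim mat_polyfunE) (rule mat_polyfunI[OF pf_mult], auto)

lemma mat_polyfun_diff:
  assumes "f \<in> mat_polyfun" "g \<in> mat_polyfun"
  shows "(\<lambda>A. f A - g A) \<in> mat_polyfun"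
  using mat_polyfun_add[OF assms(1) mat_polyfun_mult[OF mat_polyfun_const[of "-1"] assms(2)]]
  by simp

lemmas mat_polyfun_intros =
  mat_polyfun_const mat_polyfun_entry mat_polyfun_add mat_polyfun_mult mat_polyfun_diff

lemma mat_polyfun_compose:
  assumes "p \<in> polyfun I" "\<And>i. i \<in> I \<Longrightarrow> f i \<in> mat_polyfun"
  shows "(\<lambda>A. p (\<lambda>i. f i A)) \<in> mat_polyfun"
  using assms(1)
  by induction (simp_all add: assms(2) mat_polyfun_const mat_polyfun_add mat_polyfun_mult)

definition poly_mat_map :: "(complex mat \<Rightarrow> complex mat) set" where
  "poly_mat_map = {\<Phi>. (\<forall>A \<in> carrier_mat 3 3. \<Phi> A \<in> carrier_mat 3 3) \<and>
     (\<forall>i<3. \<forall>j<3. (\<lambda>A. \<Phi> A $$ (i,j)) \<in> mat_polyfun)}"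

lemma poly_mat_map_carrier: "\<Phi> \<in> poly_mat_map \<Longrightarrow> A \<in> carrier_mat 3 3 \<Longrightarrow> \<Phi> A \<in> carrier_mat 3 3"
  by (simp add: poly_mat_map_def)

lemma mat_polyfun_map_entry: "\<Phi> \<in> poly_mat_map \<Longrightarrow> i < 3 \<Longrightarrow> j < 3 \<Longrightarrow> (\<lambda>A. \<Phi> A $$ (i,j)) \<in> mat_polyfun"
  by (simp_all add: poly_mat_map_def)

lemma mat_polyfun_compose_map:
  assumes "f \<in> mat_polyfun" "\<Phi> \<in> poly_mat_map"
  shows "(\<lambda>A. f (\<Phi> A)) \<in> mat_polyfun"
proof -
  obtain p where p: "p \<in> polyfun ({..<3} \<times> {..<3})"
    "\<And>A. A \<in> carrier_mat 3 3 \<Longrightarrow> f A = p (\<lambda>ij. A $$ ij)"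
    by (rule mat_polyfunE[OF assms(1)]) (rule that)
  have "(\<lambda>A. p (\<lambda>ij. \<Phi> A $$ ij)) \<in> mat_polyfun"
    using mat_polyfun_map_entry[OF assms(2)] by (intro mat_polyfun_compose[OF p(1)]) auto
  then show ?thesis
    by (rule mat_polyfun_cong) (simp add: p(2) poly_mat_map_carrier[OF assms(2)])
qed

lemma mat_polyfun_tr: "tr \<in> mat_polyfun"
  by (rule mat_polyfun_cong[OF _ tr_3]) (intro mat_polyfun_intros; simp)

lemma mat_polyfun_det: "det \<in> mat_polyfun"
  by (rule mat_polyfun_cong[OF _ det_3]) (intro mat_polyfun_intros; simp)

lemma poly_mat_map_mult:
  assumes "\<Phi> \<in> poly_mat_map" "\<Psi> \<in> poly_mat_map"
  shows "(\<lambda>A. \<Phi> A * \<Psi> A) \<in> poly_mat_map"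
proof -
  note carrier = poly_mat_map_carrier[OF assms(1)] poly_mat_map_carrier[OF assms(2)]
  have "(\<lambda>A. (\<Phi> A * \<Psi> A) $$ (i,j)) \<in> mat_polyfun" if "i < 3" "j < 3" for i j
  proof (rule mat_polyfun_cong)
    show "(\<lambda>A. \<Phi> A $$ (i,0) * \<Psi> A $$ (0,j) + \<Phi> A $$ (i,1) * \<Psi> A $$ (1,j)
        + \<Phi> A $$ (i,2) * \<Psi> A $$ (2,j)) \<in> mat_polyfun"
      by (intro mat_polyfun_add mat_polyfun_mult mat_polyfun_map_entry assms that) simp_all
  qed (rule mult_mat_3[OF carrier that])
  then show ?thesis
    using mult_carrier_mat[OF carrier] by (simp add: poly_mat_map_def del: index_mult_mat)
qed

lemma poly_mat_map_c1: "c1 \<in> poly_mat_map"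
proof -
  have carrier: "c1 A \<in> carrier_mat 3 3" if "A \<in> carrier_mat 3 3" for A
    using that unfolding c1_def by (intro minus_carrier_mat) simp
  have "(\<lambda>A. c1 A $$ (i,j)) \<in> mat_polyfun" if "i < 3" "j < 3" for i j
  proof (rule mat_polyfun_cong)
    show "(\<lambda>A. A $$ (i,j) - (if i = j then 1 / 3 else 0) * tr A) \<in> mat_polyfun"
      by (intro mat_polyfun_intros mat_polyfun_tr that)
    show "c1 A $$ (i,j) = A $$ (i,j) - (if i = j then 1 / 3 else 0) * tr A"
      if "A \<in> carrier_mat 3 3" for A
      using that \<open>i < 3\<close> \<open>j < 3\<close> by (simp add: c1_def)
  qed
  with carrier show ?thesis by (simp add: poly_mat_map_def)
qed

lemma mat_polyfun_covariants:
  "d1 \<in> mat_polyfun" "d2 \<in> mat_polyfun" "d3 \<in> mat_polyfun" "c1U \<in> mat_polyfun" "c2U \<in> mat_polyfun"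
proof -
  note square = poly_mat_map_mult[OF poly_mat_map_c1 poly_mat_map_c1]
  show "d1 \<in> mat_polyfun"
    using mat_polyfun_tr by (rule mat_polyfun_cong) (rule d1_def)
  show "d2 \<in> mat_polyfun"
    using mat_polyfun_mult[OF mat_polyfun_const[of "1 / 6"]
        mat_polyfun_compose_map[OF mat_polyfun_tr square]]
    by (rule mat_polyfun_cong) (simp add: d2_def)
  show "d3 \<in> mat_polyfun"
    using mat_polyfun_mult[OF mat_polyfun_const[of "1 / 2"]
        mat_polyfun_compose_map[OF mat_polyfun_det poly_mat_map_c1]]
    by (rule mat_polyfun_cong) (simp add: d3_def)
  show "c1U \<in> mat_polyfun"
    using mat_polyfun_entry[of 2 0] by (rule mat_polyfun_cong[OF _ c1U_def]) simp_all
  show "c2U \<in> mat_polyfun"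
    using mat_polyfun_map_entry[OF square, of 2 0] by (rule mat_polyfun_cong[OF _ c2U_def]) simp_all
qed

lemma U_invariantsD:
  "f \<in> U_invariants S \<Longrightarrow> u \<in> U3 \<Longrightarrow> h \<in> carrier_mat 3 3 \<Longrightarrow> h * u = 1\<^sub>m 3 \<Longrightarrow>
    A \<in> carrier_mat 3 3 \<Longrightarrow> f (h * A * u) = f A"
  by (simp add: U_invariants_def)

lemma U_invariants_outside: "f \<in> U_invariants S \<Longrightarrow> A \<notin> S \<Longrightarrow> f A = 0"
  by (auto simp: U_invariants_def coord_ring_def restr_def)

lemma U_invariantsE:
  assumes "f \<in> U_invariants S"
  obtains p where "p \<in> mat_polyfun" "f = restr S p"
  using assms by (auto simp: U_invariants_def coord_ring_def)

lemma restr_in_U_invariants: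
  assumes S: "conj_closed S" and f: "f \<in> mat_polyfun"
    and inv: "\<And>u h A. u \<in> U3 \<Longrightarrow> h \<in> carrier_mat 3 3 \<Longrightarrow> h * u = 1\<^sub>m 3 \<Longrightarrow> A \<in> S \<Longrightarrow> f (h * A * u) = f A"
  shows "restr S f \<in> U_invariants S"
proof -
  have "restr S f (h * A * u) = restr S f A"
    if "u \<in> U3" "h \<in> carrier_mat 3 3" "h * u = 1\<^sub>m 3" "A \<in> carrier_mat 3 3" for u h A
    using inv[OF that(1-3)] conj_closed_iff[OF S that(2) U3_carrier[OF that(1)] that(3,4)]
    by (simp add: restr_def)
  then show ?thesis using f by (simp add: U_invariants_def coord_ring_def)
qed

lemma restr_N1_in_U_invariants:
  assumes "f \<in> U_invariants M1"
  shows "restr N1 f \<in> U_invariants N1"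
proof -
  obtain p where p: "p \<in> mat_polyfun" "f = restr M1 p" using U_invariantsE[OF assms] .
  have "restr N1 f = restr N1 p"
    using N1_subset_M1 by (force simp: p(2) restr_def)
  moreover have "p (h * A * u) = p A"
    if "u \<in> U3" "h \<in> carrier_mat 3 3" "h * u = 1\<^sub>m 3" "A \<in> N1" for u h A
  proof -
    have "A \<in> M1" using that N1_subset_M1 by blast
    moreover from this have "h * A * u \<in> M1"
      using conj_closedD[OF conj_closed_M1] that(2,3) U3_carrier[OF that(1)] by blast
    ultimately show ?thesis
      using U_invariantsD[OF assms that(1-3), of A] by (simp add: p(2) restr_def M1_def)
  qed
  ultimately show ?thesis using restr_in_U_invariants[OF conj_closed_N1 p(1)] by simp
qed

lemma emb_in_U_invariants:
  assumes "f \<in> U_invariants N1"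
  shows "emb f \<in> U_invariants M1"
proof -
  obtain p where p: "p \<in> mat_polyfun" "f = restr N1 p" using U_invariantsE[OF assms] .
  have p_c1: "p (c1 A) = f (c1 A)" if "A \<in> M1" for A
    using c1_in_N1[OF that] by (simp add: p(2) restr_def)
  then have "emb f = restr M1 (\<lambda>A. p (c1 A))"
    by (auto simp: emb_def restr_def)
  moreover have "p (c1 (h * A * u)) = p (c1 A)"
    if u: "u \<in> U3" and h: "h \<in> carrier_mat 3 3" and hu: "h * u = 1\<^sub>m 3" and A: "A \<in> M1" for u h A
  proof -
    have "h * A * u \<in> M1" by (rule conj_closedD[OF conj_closed_M1 A h U3_carrier[OF u] hu])
    then have "p (c1 (h * A * u)) = f (c1 (h * A * u))" by (rule p_c1)
    also have "\<dots> = f (h * c1 A * u)" by (simp only: c1_conj[OF A h U3_carrier[OF u] hu])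
    also have "\<dots> = f (c1 A)"
      using A poly_mat_map_carrier[OF poly_mat_map_c1]
      by (intro U_invariantsD[OF assms u h hu]) (simp add: M1_def)
    finally show ?thesis by (simp only: p_c1[OF A])
  qed
  ultimately show ?thesis
    using restr_in_U_invariants[OF conj_closed_M1
        mat_polyfun_compose_map[OF p(1) poly_mat_map_c1]] by simp
qed

definition covariant_values :: "'a :: comm_ring_1 \<Rightarrow> 'a \<Rightarrow> 'a \<Rightarrow> nat \<Rightarrow> 'a" where
  "covariant_values t z D i = (if i = 0 then t else if i = 1 then z ^ 2 else if i = 2 then z ^ 3
     else if i = 3 then D else z * D)"

lemma phi_outer_with_trace:
  assumes "v \<in> carrier_vec 3" "w \<in> carrier_vec 3"
  shows "phi P (outer_with_trace t v w) = P (covariant_values t (v \<bullet> w / 3) (v $ 2 * w $ 0))"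
  using outer_with_trace_in_M1[OF assms]
  unfolding phi_def restr_def covariants_outer_with_trace[OF assms] covariant_values_def[abs_def]
  by simp

lemma phi_outside: "A \<notin> M1 \<Longrightarrow> phi P A = 0"
  by (simp add: phi_def restr_def)

lemma phi_slice: "phi P (slice t z D) = P (covariant_values t z D)"
  by (simp add: slice_def phi_outer_with_trace scalar_prod_3)

lemma conj_U3_preserves_lowest_entries:
  assumes u: "u \<in> U3" and h: "h \<in> carrier_mat 3 3" and hu: "h * u = 1\<^sub>m 3"
    and v: "v \<in> carrier_vec 3" and w: "w \<in> carrier_vec 3"
  shows "(h *\<^sub>v v) $ 2 = v $ 2" "(u\<^sup>T *\<^sub>v w) $ 0 = w $ 0"
proof -
  obtain a b c where u_eq: "u = unitriangular a b c" using U3_eq_unitriangular[OF u] by blast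
  then have "h = unitriangular (- a) (a * c - b) (- c)"
    using left_inverse_unitriangular[OF h] hu by blast
  then show "(h *\<^sub>v v) $ 2 = v $ 2" by (simp only: unitriangular_mult_vec[OF v] index_vec3)
  show "(u\<^sup>T *\<^sub>v w) $ 0 = w $ 0"
    by (simp only: u_eq unitriangular_transpose_mult_vec[OF w] index_vec3)
qed

lemma phi_in_U_invariants:
  assumes "P \<in> polyfun {..<5}"
  shows "phi P \<in> U_invariants M1"
proof -
  define f where "f A = P (\<lambda>i. if i = 0 then d1 A else if i = 1 then d2 A else
    if i = 2 then d3 A else if i = 3 then c1U A else c2U A)" for A
  have phi: "phi P = restr M1 f" by (simp add: phi_def f_def[abs_def])
  have "(\<lambda>A. if i = 0 then d1 A else if i = 1 then d2 A else
      if i = 2 then d3 A else if i = 3 then c1U A else c2U A) \<in> mat_polyfun" for i :: nat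
    using mat_polyfun_covariants
    by (cases "i = 0"; cases "i = 1"; cases "i = 2"; cases "i = 3") simp_all
  then have "f \<in> mat_polyfun"
    unfolding f_def[abs_def] by (rule mat_polyfun_compose[OF assms])
  moreover have "f (h * A * u) = f A"
    if u: "u \<in> U3" and h: "h \<in> carrier_mat 3 3" and hu: "h * u = 1\<^sub>m 3" and A: "A \<in> M1" for u h A
  proof -
    obtain t v w where vw: "v \<in> carrier_vec 3" "w \<in> carrier_vec 3"
      and A_eq: "A = outer_with_trace t v w"
      using M1E[OF A] .
    note uC = U3_carrier[OF u]
    have "h *\<^sub>v v \<in> carrier_vec 3" "u\<^sup>T *\<^sub>v w \<in> carrier_vec 3"
      using h uC vw by (auto intro: mult_mat_vec_carrier[of _ 3 3])
    then have "phi P (h * A * u) = phi P A"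
      using vw unfolding A_eq outer_with_trace_conj[OF h uC hu vw]
      by (simp add: phi_outer_with_trace scalar_prod_conj[OF h uC hu vw]
          conj_U3_preserves_lowest_entries[OF u h hu vw] del: index_mult_mat_vec)
    moreover have "h * A * u \<in> M1" by (rule conj_closedD[OF conj_closed_M1 A h uC hu])
    ultimately show ?thesis using A by (simp add: phi restr_def)
  qed
  ultimately show ?thesis unfolding phi by (rule restr_in_U_invariants[OF conj_closed_M1])
qed

lemma polyfun_outer_with_trace_entry:
  assumes T: "T \<in> polyfun I"
    and V: "\<And>x. V x \<in> carrier_vec 3" "\<And>k. k < 3 \<Longrightarrow> (\<lambda>x. V x $ k) \<in> polyfun I"
    and W: "\<And>x. W x \<in> carrier_vec 3" "\<And>k. k < 3 \<Longrightarrow> (\<lambda>x. W x $ k) \<in> polyfun I"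
    and ij: "ij \<in> {..<3} \<times> {..<3}"
  shows "(\<lambda>x. outer_with_trace (T x) (V x) (W x) $$ ij) \<in> polyfun I"
proof -
  obtain i j where [simp]: "ij = (i,j)" "i < 3" "j < 3" using ij by auto
  have "(\<lambda>x. V x $ i * W x $ j + (if i = j then 1 / 3 else 0) *
      (T x - (V x $ 0 * W x $ 0 + V x $ 1 * W x $ 1 + V x $ 2 * W x $ 2))) \<in> polyfun I"
    by (intro pf_add pf_mult polyfun_diff pf_const T V(2) W(2); simp)
  then show ?thesis
    by (simp add: index_outer_with_trace[OF V(1) W(1)] scalar_prod_3[OF W(1)]
        if_distrib[of "\<lambda>u. u * _"] cong: if_cong)
qed

lemma polyfun_slice_entry:
  assumes "T \<in> polyfun I" "Z \<in> polyfun I" "D \<in> polyfun I" "ij \<in> {..<3} \<times> {..<3}"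
  shows "(\<lambda>x. slice (T x) (Z x) (D x) $$ ij) \<in> polyfun I"
proof -
  have "(\<lambda>x. vec3 0 0 1 $ k) \<in> polyfun I" "(\<lambda>x. vec3 (D x) 0 (3 * Z x) $ k) \<in> polyfun I"
    if "k < 3" for k
    using that assms(3) pf_mult[OF pf_const[of 3] assms(2)]
    by (auto simp: less_3_iff intro: pf_const)
  then show ?thesis unfolding slice_def
    by (intro polyfun_outer_with_trace_entry assms vec3_carrier)
qed

lemma U_invariant_polyfun:
  assumes "F \<in> U_invariants M1"
  obtains p where "p \<in> polyfun ({..<3} \<times> {..<3})" "\<And>A. A \<in> M1 \<Longrightarrow> F A = p (\<lambda>ij. A $$ ij)"
proof -
  obtain f where f: "f \<in> mat_polyfun" "F = restr M1 f" using U_invariantsE[OF assms] .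
  obtain p where p: "p \<in> polyfun ({..<3} \<times> {..<3})"
    "\<And>A. A \<in> carrier_mat 3 3 \<Longrightarrow> f A = p (\<lambda>ij. A $$ ij)"
    by (rule mat_polyfunE[OF f(1)]) (rule that)
  have "F A = p (\<lambda>ij. A $$ ij)" if "A \<in> M1" for A
    using that p(2) by (simp add: f(2) restr_def M1_def)
  with p(1) show thesis by (rule that)
qed

text \<open>\<open>conj_to_slice\<close> gives this where \<open>v\<^sub>2 w\<^sub>0 \<noteq> 0\<close>; both sides are polynomial in \<open>(v, w)\<close>.\<close>

lemma U_invariant_eq_slice:
  assumes F: "F \<in> U_invariants M1" and v: "v \<in> carrier_vec 3" and w: "w \<in> carrier_vec 3"
  shows "F (outer_with_trace t v w) = F (slice t (v \<bullet> w / 3) (v $ 2 * w $ 0))"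
proof -
  define V W where "V x = vec3 (x (Inl 0)) (x (Inl 1)) (x (Inl 2))"
    and "W x = vec3 (x (Inr 0)) (x (Inr 1)) (x (Inr 2))" for x :: "nat + nat \<Rightarrow> complex"
  have VW: "V x \<in> carrier_vec 3" "W x \<in> carrier_vec 3" for x by (simp_all add: V_def W_def)
  have V_poly: "(\<lambda>x. V x $ k) \<in> polyfun UNIV" and W_poly: "(\<lambda>x. W x $ k) \<in> polyfun UNIV"
    if "k < 3" for k
    using that by (auto simp: V_def W_def less_3_iff intro!: pf_var)
  obtain p where p: "p \<in> polyfun ({..<3} \<times> {..<3})" "\<And>A. A \<in> M1 \<Longrightarrow> F A = p (\<lambda>ij. A $$ ij)"
    by (rule U_invariant_polyfun[OF F]) (rule that)
  let ?A = "\<lambda>x. outer_with_trace t (V x) (W x)"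
    and ?S = "\<lambda>x. slice t (V x \<bullet> W x / 3) (V x $ 2 * W x $ 0)"
  have "(\<lambda>x. (1 / 3) * (V x $ 0 * W x $ 0 + V x $ 1 * W x $ 1 + V x $ 2 * W x $ 2)) \<in> polyfun UNIV"
    by (intro pf_add pf_mult pf_const V_poly W_poly; simp)
  then have "(\<lambda>x. V x \<bullet> W x / 3) \<in> polyfun UNIV"
    by (simp add: scalar_prod_3 VW)
  then have difference: "(\<lambda>x. p (\<lambda>ij. ?A x $$ ij) - p (\<lambda>ij. ?S x $$ ij)) \<in> polyfun UNIV"
    by (intro polyfun_diff polyfun_compose[OF p(1)] polyfun_outer_with_trace_entry
        polyfun_slice_entry pf_const pf_mult VW V_poly W_poly; simp)
  have generic: "(\<lambda>x. V x $ 2 * W x $ 0) \<in> polyfun UNIV"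
    by (intro pf_mult V_poly W_poly) simp_all
  have "p (\<lambda>ij. ?A x $$ ij) - p (\<lambda>ij. ?S x $$ ij) = 0" if "V x $ 2 * W x $ 0 \<noteq> 0" for x
  proof -
    obtain u h where "u \<in> U3" "h \<in> carrier_mat 3 3" "h * u = 1\<^sub>m 3" "h * ?A x * u = ?S x"
      using conj_to_slice[OF VW, of x x t] \<open>V x $ 2 * W x $ 0 \<noteq> 0\<close> by (metis mult_eq_0_iff)
    then have "F (?S x) = F (?A x)"
      using U_invariantsD[OF F, of u h "?A x"] VW by simp
    then show ?thesis by (simp add: p(2) slice_in_M1 outer_with_trace_in_M1 VW)
  qed
  from polyfun_eq_0_if_eq_0_off_zeros[OF difference generic this, of "\<lambda>_. 1"]
  have "F (?A x) = F (?S x)" for x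
    by (simp add: p(2) slice_in_M1 outer_with_trace_in_M1 VW V_def W_def)
  from this[of "case_sum (\<lambda>i. v $ i) (\<lambda>i. w $ i)"] show ?thesis
    using vec3_components[OF v] vec3_components[OF w] by (simp add: V_def W_def)
qed

lemma U_invariants_M1_eqI:
  assumes F: "F \<in> U_invariants M1" and G: "G \<in> U_invariants M1"
    and slice: "\<And>t z D. F (slice t z D) = G (slice t z D)"
  shows "F = G"
proof
  fix A
  show "F A = G A"
  proof (cases "A \<in> M1")
    case True
    then show ?thesis
      by (elim M1E) (simp add: U_invariant_eq_slice[OF F] U_invariant_eq_slice[OF G] slice)
  next
    case False
    then show ?thesis using U_invariants_outside F G by metis
  qed
qed

section \<open>The ideal of relations\<close>

lemma rel_idealI:
  assumes "h0 \<in> polyfun {..<5}" "h1 \<in> polyfun {..<5}" "h2 \<in> polyfun {..<5}" "h3 \<in> polyfun {..<5}"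
    and f: "\<And>x. f x = h0 x * (x 1 ^ 3 - x 2 ^ 2) + h1 x * (x 1 * x 4 - x 2 * x 3)
      + h2 x * (x 4 ^ 2 - x 1 * x 3 ^ 2) + h3 x * (x 2 * x 4 - x 1 ^ 2 * x 3)"
  shows "f \<in> rel_ideal"
proof -
  let ?h = "\<lambda>k :: nat. if k = 0 then h0 else if k = 1 then h1 else if k = 2 then h2 else h3"
  have "f = (\<lambda>x. \<Sum>k<4. ?h k x * rel k x)"
    by (rule ext)
      (simp add: f rel_def lessThan_nat_numeral lessThan_Suc eval_nat_numeral algebra_simps)
  moreover have "\<forall>k<4. ?h k \<in> polyfun {..<5}" using assms(1-4) by simp
  ultimately show ?thesis
    unfolding rel_ideal_def mem_Collect_eq by (intro exI[of _ ?h] conjI)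
qed

lemma rel_ideal_zero: "(\<lambda>x. 0) \<in> rel_ideal"
  by (rule rel_idealI[OF pf_const pf_const pf_const pf_const, of _ 0 0 0 0]) simp

lemma rel_ideal_add:
  assumes "f \<in> rel_ideal" "g \<in> rel_ideal"
  shows "(\<lambda>x. f x + g x) \<in> rel_ideal"
proof -
  obtain h where h: "f = (\<lambda>x. \<Sum>k<4. h k x * rel k x)" "\<forall>k<4. h k \<in> polyfun {..<5}"
    using assms(1) by (auto simp: rel_ideal_def)
  obtain h' where h': "g = (\<lambda>x. \<Sum>k<4. h' k x * rel k x)" "\<forall>k<4. h' k \<in> polyfun {..<5}"
    using assms(2) by (auto simp: rel_ideal_def)
  show ?thesis unfolding rel_ideal_def mem_Collect_eq using h h'
    by (intro exI[of _ "\<lambda>k x. h k x + h' k x"]) (auto intro: pf_add simp: distrib_right sum.distrib)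
qed

lemma rel_ideal_mult:
  assumes "f \<in> rel_ideal" "q \<in> polyfun {..<5}"
  shows "(\<lambda>x. q x * f x) \<in> rel_ideal"
proof -
  obtain h where h: "f = (\<lambda>x. \<Sum>k<4. h k x * rel k x)" "\<forall>k<4. h k \<in> polyfun {..<5}"
    using assms(1) by (auto simp: rel_ideal_def)
  show ?thesis unfolding rel_ideal_def mem_Collect_eq using h assms(2)
    by (intro exI[of _ "\<lambda>k x. q x * h k x"]) (auto intro: pf_mult simp: sum_distrib_left mult.assoc)
qed

lemma rel_ideal_vanishes:
  assumes "f \<in> rel_ideal"
  shows "f (covariant_values t z D) = 0"
proof -
  have "rel k (covariant_values t z D) = 0" for k
    by (simp add: rel_def covariant_values_def power2_eq_square power3_eq_cube)
  then show ?thesis using assms by (auto simp: rel_ideal_def)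
qed

definition normal_form ::
  "((nat \<Rightarrow> complex) \<Rightarrow> complex) \<Rightarrow> ((nat \<Rightarrow> complex) \<Rightarrow> complex) \<Rightarrow> ((nat \<Rightarrow> complex) \<Rightarrow> complex) \<Rightarrow>
    (nat \<Rightarrow> complex) \<Rightarrow> complex" where
  "normal_form A B C x = A x + x 2 * B x + x 4 * C x"

definition has_normal_form :: "((nat \<Rightarrow> complex) \<Rightarrow> complex) \<Rightarrow> bool" where
  "has_normal_form P \<longleftrightarrow> (\<exists>A \<in> polyfun {0,1,3}. \<exists>B \<in> polyfun {0,1}. \<exists>C \<in> polyfun {0,1,3}.
     (\<lambda>x. P x - normal_form A B C x) \<in> rel_ideal)"

lemma has_normal_formI:
  "A \<in> polyfun {0,1,3} \<Longrightarrow> B \<in> polyfun {0,1} \<Longrightarrow> C \<in> polyfun {0,1,3} \<Longrightarrow>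
    (\<lambda>x. P x - normal_form A B C x) \<in> rel_ideal \<Longrightarrow> has_normal_form P"
  unfolding has_normal_form_def by blast

lemma has_normal_formE:
  assumes "has_normal_form P"
  obtains A B C where "A \<in> polyfun {0,1,3}" "B \<in> polyfun {0,1}" "C \<in> polyfun {0,1,3}"
    "(\<lambda>x. P x - normal_form A B C x) \<in> rel_ideal"
  using assms unfolding has_normal_form_def by blast

lemma polyfun_01_imp_013: "p \<in> polyfun {0,1} \<Longrightarrow> p \<in> polyfun {0,1,3::nat}"
  by (erule polyfun_mono) auto

lemma polyfun_013_imp_lessThan_5: "p \<in> polyfun {0,1,3} \<Longrightarrow> p \<in> polyfun {..<5::nat}"
  by (erule polyfun_mono) auto

lemma has_normal_form_base_var_mult:
  assumes A: "A \<in> polyfun {0,1,3}" and B: "B \<in> polyfun {0,1}" and C: "C \<in> polyfun {0,1,3}"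
    and i: "i \<in> {0,1}"
  shows "has_normal_form (\<lambda>x. x i * normal_form A B C x)"
proof (rule has_normal_formI)
  show "(\<lambda>x. x i * A x) \<in> polyfun {0,1,3}" "(\<lambda>x. x i * C x) \<in> polyfun {0,1,3}"
    using i by (intro pf_mult pf_var A C; blast)+
  show "(\<lambda>x. x i * B x) \<in> polyfun {0,1}"
    by (intro pf_mult pf_var i B)
  show "(\<lambda>x. x i * normal_form A B C x
      - normal_form (\<lambda>x. x i * A x) (\<lambda>x. x i * B x) (\<lambda>x. x i * C x) x) \<in> rel_ideal"
    by (simp add: normal_form_def algebra_simps rel_ideal_zero)
qed

lemma has_normal_form_x2_mult:
  assumes A: "A \<in> polyfun {0,1,3}" and B: "B \<in> polyfun {0,1}" and C: "C \<in> polyfun {0,1,3}"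
  shows "has_normal_form (\<lambda>x. x 2 * normal_form A B C x)"
proof -
  obtain A' where A': "A' \<in> polyfun {0,1,3}" and A_split: "\<And>x. A x = A (x(3 := 0)) + x 3 * A' x"
    by (rule polyfun_split_var[OF A, of 3]) (simp, rule that)
  let ?A = "\<lambda>x. x 1 ^ 3 * B x + x 1 ^ 2 * x 3 * C x" and ?C = "\<lambda>x. x 1 * A' x"
  show ?thesis
  proof (rule has_normal_formI)
    show "?A \<in> polyfun {0,1,3}" "?C \<in> polyfun {0,1,3}"
      by (intro polyfun_intros polyfun_01_imp_013[OF B] C A'; simp)+
    show "(\<lambda>x. A (x(3 := 0))) \<in> polyfun {0,1}"
      by (rule polyfun_mono[OF polyfun_fix_var[OF A]]) auto
    show "(\<lambda>x. x 2 * normal_form A B C x - normal_form ?A (\<lambda>x. A (x(3 := 0))) ?C x) \<in> rel_ideal"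
    proof (rule rel_idealI)
      show "x 2 * normal_form A B C x - normal_form ?A (\<lambda>x. A (x(3 := 0))) ?C x
        = - B x * (x 1 ^ 3 - x 2 ^ 2) + - A' x * (x 1 * x 4 - x 2 * x 3)
          + 0 * (x 4 ^ 2 - x 1 * x 3 ^ 2) + C x * (x 2 * x 4 - x 1 ^ 2 * x 3)" for x
        using A_split[of x] by (simp add: normal_form_def algebra_simps power2_eq_square)
    qed (intro polyfun_uminus pf_const polyfun_013_imp_lessThan_5 polyfun_01_imp_013 A' B C)+
  qed
qed

lemma has_normal_form_x3_mult:
  assumes A: "A \<in> polyfun {0,1,3}" and B: "B \<in> polyfun {0,1}" and C: "C \<in> polyfun {0,1,3}"
  shows "has_normal_form (\<lambda>x. x 3 * normal_form A B C x)"
proof (rule has_normal_formI)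
  let ?A = "\<lambda>x. x 3 * A x" and ?C = "\<lambda>x. x 3 * C x + x 1 * B x"
  show "?A \<in> polyfun {0,1,3}" "?C \<in> polyfun {0,1,3}"
    by (intro polyfun_intros A polyfun_01_imp_013[OF B] C; simp)+
  show "(\<lambda>x. x 3 * normal_form A B C x - normal_form ?A (\<lambda>x. 0) ?C x) \<in> rel_ideal"
  proof (rule rel_idealI)
    show "x 3 * normal_form A B C x - normal_form ?A (\<lambda>x. 0) ?C x
      = 0 * (x 1 ^ 3 - x 2 ^ 2) + - B x * (x 1 * x 4 - x 2 * x 3)
        + 0 * (x 4 ^ 2 - x 1 * x 3 ^ 2) + 0 * (x 2 * x 4 - x 1 ^ 2 * x 3)" for x
      by (simp add: normal_form_def algebra_simps)
  qed (intro polyfun_uminus pf_const polyfun_013_imp_lessThan_5 polyfun_01_imp_013 B)+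
qed (rule pf_const)

lemma has_normal_form_x4_mult:
  assumes A: "A \<in> polyfun {0,1,3}" and B: "B \<in> polyfun {0,1}" and C: "C \<in> polyfun {0,1,3}"
  shows "has_normal_form (\<lambda>x. x 4 * normal_form A B C x)"
proof (rule has_normal_formI)
  let ?A = "\<lambda>x. x 1 ^ 2 * x 3 * B x + x 1 * x 3 ^ 2 * C x"
  show "?A \<in> polyfun {0,1,3}"
    by (intro polyfun_intros polyfun_01_imp_013[OF B] C; simp)
  show "(\<lambda>x. x 4 * normal_form A B C x - normal_form ?A (\<lambda>x. 0) A x) \<in> rel_ideal"
  proof (rule rel_idealI)
    show "x 4 * normal_form A B C x - normal_form ?A (\<lambda>x. 0) A x
      = 0 * (x 1 ^ 3 - x 2 ^ 2) + 0 * (x 1 * x 4 - x 2 * x 3)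
        + C x * (x 4 ^ 2 - x 1 * x 3 ^ 2) + B x * (x 2 * x 4 - x 1 ^ 2 * x 3)" for x
      by (simp add: normal_form_def algebra_simps power2_eq_square)
  qed (intro pf_const polyfun_013_imp_lessThan_5 polyfun_01_imp_013 B C)+
qed (rule pf_const A)+

lemma has_normal_form_var_mult:
  assumes "has_normal_form q" and i: "i < 5"
  shows "has_normal_form (\<lambda>x. x i * q x)"
proof -
  obtain A B C where nf: "A \<in> polyfun {0,1,3}" "B \<in> polyfun {0,1}" "C \<in> polyfun {0,1,3}"
    and q: "(\<lambda>x. q x - normal_form A B C x) \<in> rel_ideal"
    using has_normal_formE[OF assms(1)] .
  consider "i \<in> {0,1}" | "i = 2" | "i = 3" | "i = 4" using i by fastforce
  then have "has_normal_form (\<lambda>x. x i * normal_form A B C x)"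
    using nf by cases (simp_all only: has_normal_form_base_var_mult has_normal_form_x2_mult
        has_normal_form_x3_mult has_normal_form_x4_mult)
  then obtain A' B' C' where
    nf': "A' \<in> polyfun {0,1,3}" "B' \<in> polyfun {0,1}" "C' \<in> polyfun {0,1,3}"
    and r: "(\<lambda>x. x i * normal_form A B C x - normal_form A' B' C' x) \<in> rel_ideal"
    by (rule has_normal_formE)
  have "(\<lambda>x. x i) \<in> polyfun {..<5}" using i by (intro pf_var) simp
  from rel_ideal_add[OF rel_ideal_mult[OF q this] r]
  have "(\<lambda>x. x i * q x - normal_form A' B' C' x) \<in> rel_ideal" by (simp add: algebra_simps)
  with nf' show ?thesis by (rule has_normal_formI)
qed

lemma has_normal_form_scale:
  assumes "has_normal_form q"
  shows "has_normal_form (\<lambda>x. c * q x)"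
proof -
  obtain A B C where nf: "A \<in> polyfun {0,1,3}" "B \<in> polyfun {0,1}" "C \<in> polyfun {0,1,3}"
    and q: "(\<lambda>x. q x - normal_form A B C x) \<in> rel_ideal"
    using has_normal_formE[OF assms] .
  have "(\<lambda>x. c * q x - normal_form (\<lambda>x. c * A x) (\<lambda>x. c * B x) (\<lambda>x. c * C x) x) \<in> rel_ideal"
    using rel_ideal_mult[OF q pf_const[of c]] by (simp add: normal_form_def algebra_simps)
  then show ?thesis
    by (rule has_normal_formI[rotated -1]) (intro pf_mult pf_const nf)+
qed

lemma has_normal_form_add:
  assumes "has_normal_form q" "has_normal_form r"
  shows "has_normal_form (\<lambda>x. q x + r x)"
proof -
  obtain A B C where nf: "A \<in> polyfun {0,1,3}" "B \<in> polyfun {0,1}" "C \<in> polyfun {0,1,3}"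
    and q: "(\<lambda>x. q x - normal_form A B C x) \<in> rel_ideal"
    using has_normal_formE[OF assms(1)] .
  obtain A' B' C' where
    nf': "A' \<in> polyfun {0,1,3}" "B' \<in> polyfun {0,1}" "C' \<in> polyfun {0,1,3}"
    and r: "(\<lambda>x. r x - normal_form A' B' C' x) \<in> rel_ideal"
    using has_normal_formE[OF assms(2)] .
  have "(\<lambda>x. q x + r x
      - normal_form (\<lambda>x. A x + A' x) (\<lambda>x. B x + B' x) (\<lambda>x. C x + C' x) x) \<in> rel_ideal"
    using rel_ideal_add[OF q r] by (simp add: normal_form_def algebra_simps)
  then show ?thesis
    by (rule has_normal_formI[rotated -1]) (intro pf_add nf nf')+
qed

lemma has_normal_form_one: "has_normal_form (\<lambda>x. 1)"
  by (rule has_normal_formI[OF pf_const[of 1] pf_const[of 0] pf_const[of 0]])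
    (simp add: normal_form_def rel_ideal_zero)

lemma polyfun_has_normal_form:
  assumes "P \<in> polyfun {..<5}"
  shows "has_normal_form P"
  using assms
  by (induction rule: polyfun_var_mult_induct)
    (simp_all add: has_normal_form_one has_normal_form_scale has_normal_form_add
      has_normal_form_var_mult)

lemma polyfun_cong_covariant_values:
  assumes "p \<in> polyfun {0,1,3}"
  shows "p (covariant_values (x 0) (csqrt (x 1)) (x 3)) = p x"
    and "p (covariant_values t (- z) D) = p (covariant_values t z D)"
  by (auto intro!: polyfun_cong[OF assms] simp: covariant_values_def)

text \<open>Separating the parts even and odd in \<open>z\<close> leaves \<open>A = 0\<close> and \<open>z\<^sup>2 B + D C = 0\<close>.\<close>

lemma normal_form_vanishing:
  assumes A: "A \<in> polyfun {0,1,3}" and B: "B \<in> polyfun {0,1}" and C: "C \<in> polyfun {0,1,3}"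
    and zero: "\<And>t z D. normal_form A B C (covariant_values t z D) = 0"
  shows "A x = 0" "B x = 0" "C x = 0"
proof -
  define E where "E x = x 1 * B x + x 3 * C x" for x
  have E: "E \<in> polyfun {0,1,3}"
    unfolding E_def[abs_def] by (intro pf_add pf_mult pf_var polyfun_01_imp_013[OF B] C) simp_all
  have even_odd: "A (covariant_values t z D) + z * E (covariant_values t z D) = 0" for t z D
    using zero[of t z D]
    by (simp add: normal_form_def E_def covariant_values_def
        algebra_simps power2_eq_square power3_eq_cube)
  have "A (covariant_values t z D) - z * E (covariant_values t z D) = 0" for t z D
    using even_odd[of t "- z" D]
    by (simp add: polyfun_cong_covariant_values(2)[OF A] polyfun_cong_covariant_values(2)[OF E])
  then have "(A (covariant_values t z D) + z * E (covariant_values t z D))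
      + (A (covariant_values t z D) - z * E (covariant_values t z D)) = 0" for t z D
    by (simp only: even_odd add_0)
  then have A_covariant: "A (covariant_values t z D) = 0" for t z D by simp
  then have E_covariant: "z * E (covariant_values t z D) = 0" for t z D
    using even_odd[of t z D] by simp
  have A0: "A x = 0" for x
    using A_covariant polyfun_cong_covariant_values(1)[OF A, of x] by simp
  have "csqrt (x 1) * E x = 0" for x
    using E_covariant polyfun_cong_covariant_values(1)[OF E, of x] by metis
  then have E0: "E x = 0" for x
    by (intro polyfun_eq_0_if_var_mult_eq_0[OF E, of 1]) simp
  have "B (x(3 := 0)) = B x" for x by (rule polyfun_upd_free[OF B]) simp
  then have "x 1 * B x = 0" for x using E0[of "x(3 := 0)"] by (simp add: E_def)
  then have B0: "B x = 0" for x by (rule polyfun_eq_0_if_var_mult_eq_0[OF B])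
  then have "x 3 * C x = 0" for x using E0[of x] by (simp add: E_def)
  then have "C x = 0" for x by (rule polyfun_eq_0_if_var_mult_eq_0[OF C])
  with A0 B0 show "A x = 0" "B x = 0" "C x = 0" by blast+
qed

lemma rel_ideal_iff_vanishes:
  assumes "P \<in> polyfun {..<5}"
  shows "P \<in> rel_ideal \<longleftrightarrow> (\<forall>t z D. P (covariant_values t z D) = 0)"
proof
  assume vanishes: "\<forall>t z D. P (covariant_values t z D) = 0"
  obtain A B C where nf: "A \<in> polyfun {0,1,3}" "B \<in> polyfun {0,1}" "C \<in> polyfun {0,1,3}"
    and P: "(\<lambda>x. P x - normal_form A B C x) \<in> rel_ideal"
    using polyfun_has_normal_form[OF assms] by (rule has_normal_formE)
  have "normal_form A B C (covariant_values t z D) = 0" for t z D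
    using rel_ideal_vanishes[OF P, of t z D] vanishes by simp
  from normal_form_vanishing[OF nf this] have "normal_form A B C x = 0" for x
    by (simp add: normal_form_def)
  with P show "P \<in> rel_ideal" by simp
qed (simp add: rel_ideal_vanishes)

lemma phi_eq_0_iff:
  assumes "P \<in> polyfun {..<5}"
  shows "phi P = (\<lambda>A. 0) \<longleftrightarrow> P \<in> rel_ideal"
  unfolding rel_ideal_iff_vanishes[OF assms]
proof
  show "\<forall>t z D. P (covariant_values t z D) = 0" if "phi P = (\<lambda>A. 0)"
    using that by (simp flip: phi_slice)
  show "phi P = (\<lambda>A. 0)" if "\<forall>t z D. P (covariant_values t z D) = 0"
  proof
    show "phi P A = 0" for A
      using that by (cases "A \<in> M1") (auto elim!: M1E simp: phi_outer_with_trace phi_outside)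
  qed
qed

section \<open>Invariants as polynomials in the covariants\<close>

definition diagonal_direction :: "nat \<Rightarrow> nat \<times> nat \<Rightarrow> complex" where
  "diagonal_direction k = (\<lambda>(i,j). if i = j then (if i = k then 2 else - 1) else 0)"

lemma diagonal_direction_sum:
  assumes "ij \<in> {..<3} \<times> {..<3}"
  shows "diagonal_direction 0 ij + diagonal_direction 1 ij + diagonal_direction 2 ij = 0"
  using assms by (auto simp: diagonal_direction_def less_3_iff)

lemma U_invariant_along_diagonal_direction:
  assumes F: "F \<in> U_invariants M1" and k: "k < 3"
    and p: "p \<in> polyfun ({..<3} \<times> {..<3})" "\<And>A. A \<in> M1 \<Longrightarrow> F A = p (\<lambda>ij. A $$ ij)"
  shows "p (\<lambda>ij. ((t / 3) \<cdot>\<^sub>m 1\<^sub>m 3) $$ ij + s * diagonal_direction k ij) = F (slice t s 0)"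
proof -
  let ?v = "unit_vec 3 k :: complex vec" and ?w = "3 * s \<cdot>\<^sub>v unit_vec 3 k"
  have "outer_with_trace t ?v ?w $$ ij = ((t / 3) \<cdot>\<^sub>m 1\<^sub>m 3) $$ ij + s * diagonal_direction k ij"
    if "ij \<in> {..<3} \<times> {..<3}" for ij
    using that k by (auto simp: index_outer_with_trace diagonal_direction_def field_simps)
  from polyfun_cong[OF p(1) this]
  have "p (\<lambda>ij. ((t / 3) \<cdot>\<^sub>m 1\<^sub>m 3) $$ ij + s * diagonal_direction k ij)
      = F (outer_with_trace t ?v ?w)"
    by (simp add: p(2) outer_with_trace_in_M1)
  moreover have "?v $ 2 * ?w $ 0 = 0" using k by (simp add: less_3_iff)
  then have "F (outer_with_trace t ?v ?w) = F (slice t s 0)"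
    using k U_invariant_eq_slice[OF F, of ?v ?w t] by simp
  ultimately show ?thesis by (rule trans)
qed

text \<open>The three diagonal directions give the same function of \<open>s\<close> and add up to zero.\<close>

lemma U_invariant_slice_derivative:
  assumes F: "F \<in> U_invariants M1"
  shows "((\<lambda>s. F (slice t s 0)) has_field_derivative 0) (at 0)"
proof -
  let ?I = "{..<3} \<times> {..<3} :: (nat \<times> nat) set"
  obtain p where p: "p \<in> polyfun ?I" "\<And>A. A \<in> M1 \<Longrightarrow> F A = p (\<lambda>ij. A $$ ij)"
    by (rule U_invariant_polyfun[OF F]) (rule that)
  obtain l where l: "\<And>d. ((\<lambda>s. p (\<lambda>ij. ((t / 3) \<cdot>\<^sub>m 1\<^sub>m 3) $$ ij + s * d ij))
      has_field_derivative (\<Sum>ij\<in>?I. l ij * d ij)) (at 0)"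
    using polyfun_directional_derivative[OF p(1)] by blast
  define L where "L k = (\<Sum>ij\<in>?I. l ij * diagonal_direction k ij)" for k
  have derivative: "((\<lambda>s. F (slice t s 0)) has_field_derivative L k) (at 0)" if "k < 3" for k
    using l[of "diagonal_direction k"] U_invariant_along_diagonal_direction[OF F that p, of t]
    by (simp only: L_def)
  have "L 0 + L 1 + L 2 = (\<Sum>ij\<in>?I. l ij *
      (diagonal_direction 0 ij + diagonal_direction 1 ij + diagonal_direction 2 ij))"
    by (simp add: L_def sum.distrib distrib_left)
  also have "\<dots> = 0"
    by (intro sum.neutral ballI) (simp only: diagonal_direction_sum mult_zero_right)
  finally have "L 0 + L 1 + L 2 = 0" .
  moreover have "L 1 = L 0" "L 2 = L 0"
    using DERIV_unique[OF derivative derivative] by simp_all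
  ultimately have "L 0 = 0" by simp
  with derivative[of 0] show ?thesis by simp
qed

lemma U_invariant_slice_even_odd:
  assumes F: "F \<in> U_invariants M1"
  obtains a b where "a \<in> polyfun {0,1,3}" "b \<in> polyfun {0,1,3}"
    "\<And>t z D. F (slice t z D) = a (covariant_values t z D) + z * b (covariant_values t z D)"
proof -
  obtain p where p: "p \<in> polyfun ({..<3} \<times> {..<3})" "\<And>A. A \<in> M1 \<Longrightarrow> F A = p (\<lambda>ij. A $$ ij)"
    by (rule U_invariant_polyfun[OF F]) (rule that)
  have "(\<lambda>x. p (\<lambda>ij. slice (x 0) (x 1) (x 3) $$ ij)) \<in> polyfun {0,1,3}"
    by (intro polyfun_compose[OF p(1)] polyfun_slice_entry pf_var) simp_all
  then have "(\<lambda>x. F (slice (x 0) (x 1) (x 3))) \<in> polyfun {0,1,3}"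
    by (simp add: p(2) slice_in_M1)
  then obtain a b :: "(nat \<Rightarrow> complex) \<Rightarrow> complex"
    where ab: "a \<in> polyfun {0,1,3}" "b \<in> polyfun {0,1,3}"
    and F_eq: "\<And>x. F (slice (x 0) (x 1) (x 3)) = a (x(1 := x 1 ^ 2)) + x 1 * b (x(1 := x 1 ^ 2))"
    by (rule polyfun_even_odd[where i = 1]) (simp, rule that)
  have "F (slice t z D) = a (covariant_values t z D) + z * b (covariant_values t z D)" for t z D
  proof -
    let ?x = "(covariant_values t z D)(1 := z)"
    have "?x(1 := ?x 1 ^ 2) = covariant_values t z D" "?x 0 = t" "?x 1 = z" "?x 3 = D"
      by (auto simp: covariant_values_def)
    then show ?thesis using F_eq[of ?x] by simp
  qed
  with ab show thesis by (rule that)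
qed

lemma odd_part_vanishes_at_0:
  assumes F: "F \<in> U_invariants M1" and ab: "a \<in> polyfun {0,1,3}" "b \<in> polyfun {0,1,3}"
    and F_eq: "\<And>t z D. F (slice t z D) =
      a (covariant_values t z D) + z * b (covariant_values t z D)"
  shows "b (covariant_values t 0 0) = 0"
proof -
  define f where "f s = F (slice t s 0)" for s
  have f': "(f has_field_derivative 0) (at 0)"
    using U_invariant_slice_derivative[OF F] by (simp add: f_def[abs_def])
  have "((\<lambda>s. f (- s)) has_field_derivative 0 * - 1) (at 0)"
    by (rule DERIV_chain2[of f]) (use f' in \<open>auto intro!: derivative_eq_intros\<close>)
  from DERIV_diff[OF f' this]
  have odd': "((\<lambda>s. f s - f (- s)) has_field_derivative 0) (at 0)" by simp
  obtain r where r: "\<And>s. b (\<lambda>i. poly (covariant_values [:t:] [:0, 1:] 0 i) s) = poly r s"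
    using polyfun_along_curve[OF ab(2)] by metis
  have "(\<lambda>i. poly (covariant_values [:t:] [:0, 1:] 0 i) s) = covariant_values t s 0" for s
    by (auto simp: covariant_values_def)
  then have b: "b (covariant_values t s 0) = poly r s" for s using r by simp
  have "f s - f (- s) = poly ([:0, 2:] * r) s" for s
    unfolding f_def F_eq polyfun_cong_covariant_values(2)[OF ab(1)]
      polyfun_cong_covariant_values(2)[OF ab(2)] b
    by simp
  with odd' have "(poly ([:0, 2:] * r) has_field_derivative 0) (at 0)" by (simp only:)
  from DERIV_unique[OF poly_DERIV this] show ?thesis by (simp add: pderiv_mult pderiv_pCons b)
qed

lemma U_invariant_is_phi:
  assumes F: "F \<in> U_invariants M1"
  shows "\<exists>P \<in> polyfun {..<5}. F = phi P"
proof -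
  obtain a b where ab: "a \<in> polyfun {0,1,3}" "b \<in> polyfun {0,1,3}"
    and F_eq: "\<And>t z D. F (slice t z D) =
      a (covariant_values t z D) + z * b (covariant_values t z D)"
    by (rule U_invariant_slice_even_odd[OF F]) (rule that)
  have "b (x(1 := 0, 3 := 0)) = b (covariant_values (x 0) 0 0)" for x
    by (rule polyfun_cong[OF ab(2)]) (auto simp: covariant_values_def)
  then have "b (x(1 := 0, 3 := 0)) = 0" for x
    using odd_part_vanishes_at_0[OF F ab F_eq] by simp
  then obtain B C where BC: "B \<in> polyfun ({0,1,3} - {3})" "C \<in> polyfun {0,1,3}"
    and b: "\<And>x. b x = x 1 * B x + x 3 * C x"
    by (rule polyfun_vanishing_on_codim_2[OF ab(2), of 1 3, rotated -2]) (simp_all add: that)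
  have B: "B \<in> polyfun {0,1,3}" by (rule polyfun_mono[OF BC(1)]) auto
  have P: "normal_form a B C \<in> polyfun {..<5}"
    unfolding normal_form_def[abs_def]
    by (intro pf_add pf_mult pf_var polyfun_013_imp_lessThan_5 ab(1) B BC(2)) simp_all
  have "F (slice t z D) = phi (normal_form a B C) (slice t z D)" for t z D
    unfolding phi_slice F_eq b normal_form_def
    by (simp add: covariant_values_def algebra_simps power2_eq_square power3_eq_cube)
  from U_invariants_M1_eqI[OF F phi_in_U_invariants[OF P] this] P show ?thesis by blast
qed

lemma phi_image: "phi ` polyfun {..<5} = U_invariants M1"
  using phi_in_U_invariants U_invariant_is_phi by blast

lemma restr_M1_d1: "restr M1 d1 = phi (\<lambda>x. x 0)"
  by (simp add: phi_def)

lemma emb_outside: "A \<notin> M1 \<Longrightarrow> emb f A = 0"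
  by (simp add: emb_def restr_def)

lemma emb_outer_with_trace:
  "v \<in> carrier_vec 3 \<Longrightarrow> w \<in> carrier_vec 3 \<Longrightarrow>
    emb f (outer_with_trace t v w) = f (outer_with_trace 0 v w)"
  by (simp add: emb_def restr_def c1_outer_with_trace outer_with_trace_in_M1)

lemma emb_restr_phi:
  assumes "P \<in> polyfun {1..<5}"
  shows "emb (restr N1 (phi P)) = phi P"
proof
  fix A
  have P_cong: "P (covariant_values 0 z D) = P (covariant_values t z D)" for t z D
    by (rule polyfun_cong[OF assms]) (auto simp: covariant_values_def)
  show "emb (restr N1 (phi P)) A = phi P A"
  proof (cases "A \<in> M1")
    case True
    then show ?thesis
      by (elim M1E)
        (simp add: emb_outer_with_trace restr_def outer_with_trace_in_N1
          phi_outer_with_trace P_cong)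
  qed (simp add: emb_outside phi_outside)
qed

lemma U_invariants_N1_eq: "U_invariants N1 = (\<lambda>P. restr N1 (phi P)) ` polyfun {1..<5}"
proof (intro equalityI subsetI)
  fix f assume f: "f \<in> U_invariants N1"
  obtain P where P: "P \<in> polyfun {..<5}" "emb f = phi P"
    using U_invariant_is_phi[OF emb_in_U_invariants[OF f]] by blast
  let ?P = "\<lambda>x. P (x(0 := 0))"
  have "{..<5} - {0} = {1..<5 :: nat}" by auto
  then have "?P \<in> polyfun {1..<5}" using polyfun_fix_var[OF P(1), of 0 0] by simp
  moreover have "f A = restr N1 (phi ?P) A" for A
  proof (cases "A \<in> N1")
    case True
    then obtain v w where vw: "v \<in> carrier_vec 3" "w \<in> carrier_vec 3"
      and A: "A = outer_with_trace 0 v w"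
      by (rule N1E)
    have "(covariant_values 0 z D)(0 := 0) = covariant_values 0 z D" for z D :: complex
      by (auto simp: covariant_values_def)
    then have "phi ?P A = phi P A" by (simp add: A phi_outer_with_trace vw)
    also have "\<dots> = f A" unfolding A P(2)[symmetric] by (rule emb_outer_with_trace[OF vw])
    finally show ?thesis using True by (simp add: restr_def)
  next
    case False
    then show ?thesis using U_invariants_outside[OF f] by (simp add: restr_def)
  qed
  ultimately show "f \<in> (\<lambda>P. restr N1 (phi P)) ` polyfun {1..<5}"
    by (intro image_eqI[of _ _ ?P]) auto
next
  fix f assume "f \<in> (\<lambda>P. restr N1 (phi P)) ` polyfun {1..<5}"
  then obtain P where P: "P \<in> polyfun {1..<5}" and f: "f = restr N1 (phi P)" by blast
  have "P \<in> polyfun {..<5}" by (rule polyfun_mono[OF P]) auto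
  then show "f \<in> U_invariants N1" unfolding f
    by (intro restr_N1_in_U_invariants phi_in_U_invariants)
qed

lemma U_invariants_M1_expand:
  assumes F: "F \<in> U_invariants M1"
  shows "\<exists>n g. (\<forall>i\<le>n. g i \<in> U_invariants N1) \<and> F = (\<lambda>A. \<Sum>i\<le>n. emb (g i) A * restr M1 d1 A ^ i)"
proof -
  obtain P where P: "P \<in> polyfun {..<5}" "F = phi P" using U_invariant_is_phi[OF F] by blast
  obtain n :: nat and g where "\<And>k. g k \<in> polyfun ({..<5} - {0})"
    and P_eq: "\<And>x. P x = (\<Sum>k\<le>n. g k x * x 0 ^ k)"
    by (rule polyfun_expand_var[OF P(1), of 0]) (rule that)
  moreover have "{..<5} - {0} = {1..<5 :: nat}" by auto
  ultimately have g: "\<And>k. g k \<in> polyfun {1..<5}" by simp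
  have "F = (\<lambda>A. \<Sum>k\<le>n. emb (restr N1 (phi (g k))) A * restr M1 d1 A ^ k)"
    unfolding emb_restr_phi[OF g] by (auto simp: P(2) phi_def restr_def P_eq)
  moreover have "\<forall>k\<le>n. restr N1 (phi (g k)) \<in> U_invariants N1"
    using g by (simp add: U_invariants_N1_eq)
  ultimately show ?thesis by (intro exI[of _ n, OF exI[of _ "\<lambda>k. restr N1 (phi (g k))"]]) blast
qed

lemma U_invariants_N1_independent:
  assumes g: "\<And>i. i \<le> n \<Longrightarrow> g i \<in> U_invariants N1"
    and eq: "(\<lambda>A. \<Sum>i\<le>n. emb (g i) A * restr M1 d1 A ^ i) = (\<lambda>A. 0)"
    and i: "i \<le> n"
  shows "g i = (\<lambda>A. 0)"
proof
  fix A
  show "g i A = 0"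
  proof (cases "A \<in> N1")
    case True
    then obtain v w where vw: "v \<in> carrier_vec 3" "w \<in> carrier_vec 3"
      and A: "A = outer_with_trace 0 v w"
      by (rule N1E)
    have "(\<Sum>i\<le>n. g i A * t ^ i) = 0" for t
      using fun_cong[OF eq, of "outer_with_trace t v w"]
      by (simp add: emb_outer_with_trace restr_M1_d1 phi_outer_with_trace vw A covariant_values_def)
    then show ?thesis using polyfun_eq_0[of "\<lambda>i. g i A" n] i by blast
  next
    case False
    then show ?thesis using U_invariants_outside[OF g[OF i]] by simp
  qed
qed

lemma zD_subalg_eq: "zD_subalg = (\<lambda>P x. P (covariant_values 0 (x 0) (x 1))) ` polyfun {1..<5}"
proof -
  let ?f = "\<lambda>i (x :: nat \<Rightarrow> complex). covariant_values 0 (x 0) (x 1) i"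
  have "{1..<5} = {1, 2, 3, 4 :: nat}" by auto
  then have "?f ` {1..<5} = {\<lambda>x. x 0 ^ 2, \<lambda>x. x 0 ^ 3, \<lambda>x. x 1, \<lambda>x. x 0 * x 1}"
    by (simp add: covariant_values_def)
  with gen_subalg_image[of ?f "{1..<5}"] show ?thesis
    unfolding zD_subalg_def by (simp only:)
qed

text \<open>On \<open>N1\<close> the quotient \<open>d3 / d2\<close> recovers \<open>z\<close>, even where \<open>d2 = 0\<close>: there \<open>z = 0 = 0 / 0\<close>.\<close>

definition eta :: "((nat \<Rightarrow> complex) \<Rightarrow> complex) \<Rightarrow> complex mat \<Rightarrow> complex" where
  "eta p = restr N1 (\<lambda>A. p (\<lambda>i. if i = 0 then d3 A / d2 A else c1U A))"

lemma eta_outer_with_trace: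
  assumes "v \<in> carrier_vec 3" "w \<in> carrier_vec 3"
  shows "eta p (outer_with_trace 0 v w) = p (\<lambda>i. if i = 0 then v \<bullet> w / 3 else v $ 2 * w $ 0)"
proof -
  have "z ^ 3 / z ^ 2 = z" for z :: complex
    by (cases "z = 0") (simp_all add: power2_eq_square power3_eq_cube)
  then show ?thesis
    unfolding eta_def restr_def covariants_outer_with_trace[OF assms]
    by (simp only: outer_with_trace_in_N1[OF assms] if_True)
qed

lemma eta_eq_restr_N1I:
  assumes "\<And>v w. v \<in> carrier_vec 3 \<Longrightarrow> w \<in> carrier_vec 3 \<Longrightarrow>
    p (\<lambda>i. if i = 0 then v \<bullet> w / 3 else v $ 2 * w $ 0) = f (outer_with_trace 0 v w)"
  shows "eta p = restr N1 f"
proof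
  fix A
  show "eta p A = restr N1 f A"
  proof (cases "A \<in> N1")
    case True
    then show ?thesis
      by (elim N1E) (simp add: eta_outer_with_trace assms restr_def outer_with_trace_in_N1)
  qed (simp add: eta_def restr_def)
qed

lemma eta_covariant_values: "eta (\<lambda>x. P (covariant_values 0 (x 0) (x 1))) = restr N1 (phi P)"
  by (rule eta_eq_restr_N1I) (simp add: phi_outer_with_trace)

lemma bij_betw_eta: "bij_betw eta zD_subalg (U_invariants N1)"
proof (rule bij_betw_imageI)
  show "inj_on eta zD_subalg"
  proof (rule inj_onI)
    fix p q assume "p \<in> zD_subalg" "q \<in> zD_subalg" and eq: "eta p = eta q"
    then obtain P Q where p: "p = (\<lambda>x. P (covariant_values 0 (x 0) (x 1)))"
      and q: "q = (\<lambda>x. Q (covariant_values 0 (x 0) (x 1)))"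
      unfolding zD_subalg_eq by blast
    have "restr N1 (phi P) (slice 0 z D) = restr N1 (phi Q) (slice 0 z D)" for z D
      using eq unfolding p q eta_covariant_values by simp
    then show "p = q" unfolding p q by (simp add: restr_def phi_slice slice_in_N1)
  qed
  show "eta ` zD_subalg = U_invariants N1"
    by (simp only: zD_subalg_eq U_invariants_N1_eq image_image eta_covariant_values)
qed

lemma eta_generators:
  "eta (\<lambda>x. x 0 ^ 2) = restr N1 d2" "eta (\<lambda>x. x 0 ^ 3) = restr N1 d3"
  "eta (\<lambda>x. x 1) = restr N1 c1U" "eta (\<lambda>x. x 0 * x 1) = restr N1 c2U"
  by (rule eta_eq_restr_N1I, simp add: covariants_outer_with_trace)+

theorem theorem4p5:
  shows
  \<comment> \<open>(i) C[M1]^U is a polynomial ring in d1-bar over the subalgebra C[N1]^U\<close>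
  "(emb ` U_invariants N1 \<subseteq> U_invariants M1 \<and> restr M1 d1 \<in> U_invariants M1 \<and>
    (\<forall>F \<in> U_invariants M1. \<exists>n g. (\<forall>i\<le>n. g i \<in> U_invariants N1) \<and>
        F = (\<lambda>A. \<Sum>i\<le>n. emb (g i) A * restr M1 d1 A ^ i)) \<and>
    (\<forall>n g. (\<forall>i\<le>n. g i \<in> U_invariants N1) \<and>
        (\<lambda>A. \<Sum>i\<le>n. emb (g i) A * restr M1 d1 A ^ i) = (\<lambda>A. 0)
        \<longrightarrow> (\<forall>i\<le>n. g i = (\<lambda>A. 0))))
  \<and>
  \<comment> \<open>(ii) C-algebra isomorphism eta : C[z^2,z^3,D,zD] \<rightarrow> C[N1]^U\<close>
   (\<exists>\<eta>. bij_betw \<eta> zD_subalg (U_invariants N1) \<and>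
      (\<forall>p \<in> zD_subalg. \<forall>q \<in> zD_subalg.
          \<eta> (\<lambda>x. p x + q x) = (\<lambda>A. \<eta> p A + \<eta> q A) \<and>
          \<eta> (\<lambda>x. p x * q x) = (\<lambda>A. \<eta> p A * \<eta> q A)) \<and>
      (\<forall>c. \<eta> (\<lambda>x. c) = restr N1 (\<lambda>A. c)) \<and>
      \<eta> (\<lambda>x. x 0 ^ 2) = restr N1 d2 \<and>
      \<eta> (\<lambda>x. x 0 ^ 3) = restr N1 d3 \<and>
      \<eta> (\<lambda>x. x 1) = restr N1 c1U \<and>
      \<eta> (\<lambda>x. x 0 * x 1) = restr N1 c2U)
  \<and>
  \<comment> \<open>(iii) phi is onto C[M1]^U and its kernel is the ideal generated by the four relations\<close>
   (phi ` polyfun {..<5} = U_invariants M1 \<and>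
    (\<forall>P \<in> polyfun {..<5}. phi P = (\<lambda>A. 0) \<longleftrightarrow> P \<in> rel_ideal))"
proof (intro conjI exI[of _ eta] ballI allI impI)
  show "emb ` U_invariants N1 \<subseteq> U_invariants M1"
    using emb_in_U_invariants by blast
  show "restr M1 d1 \<in> U_invariants M1"
    unfolding restr_M1_d1 by (intro phi_in_U_invariants pf_var) simp
  show "\<exists>n g. (\<forall>i\<le>n. g i \<in> U_invariants N1) \<and> F = (\<lambda>A. \<Sum>i\<le>n. emb (g i) A * restr M1 d1 A ^ i)"
    if "F \<in> U_invariants M1" for F
    using U_invariants_M1_expand[OF that] .
  show "g i = (\<lambda>A. 0)"
    if "(\<forall>i\<le>n. g i \<in> U_invariants N1) \<and> (\<lambda>A. \<Sum>i\<le>n. emb (g i) A * restr M1 d1 A ^ i) = (\<lambda>A. 0)"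
      "i \<le> n" for n g i
    using U_invariants_N1_independent[of n g i] that by blast
  show "bij_betw eta zD_subalg (U_invariants N1)" by (rule bij_betw_eta)
  show "eta (\<lambda>x. p x + q x) = (\<lambda>A. eta p A + eta q A)"
    "eta (\<lambda>x. p x * q x) = (\<lambda>A. eta p A * eta q A)"
    for p q by (auto simp: eta_def restr_def)
  show "eta (\<lambda>x. c) = restr N1 (\<lambda>A. c)" for c by (simp add: eta_def)
  show "phi P = (\<lambda>A. 0) \<longleftrightarrow> P \<in> rel_ideal" if "P \<in> polyfun {..<5}" for P
    using phi_eq_0_iff[OF that] .
qed (rule eta_generators phi_image)+

end
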